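(* Let $T$ be a positive integer and let $V$ be a $\frac1T\mathbb{N}$-graded vertex superalgebra that admits a PBW basis. Then $V$ is $Y(z)$-injective, i.e. the linear map $Y(z)\colon V\otimes V\to V((z))$, $u\otimes v\mapsto Y(u,z)v$, is injective.
   Context: All vector spaces and tensor products are over $\mathbb{C}$; $\mathbb{N}=\{0,1,2,\dots\}$. A vector superspace is a $\mathbb{Z}_2$-graded vector space $V=V_{\bar 0}\oplus V_{\bar 1}$; homogeneous $u\in V_{\bar i}$ has $|u|=i$. A subsuperspace is a subspace $W$ with $W=(W\cap V_{\bar 0})\oplus (W\cap V_{\bar 1})$. A vertex superalgebra is a triple $(V,Y(\ ,z),\mathbf 1)$ with $V$ a vector superspace, $\mathbf 1\in V_{\bar 0}$, and a linear map $V\to \mathrm{End}_{\mathbb{C}}(V)[[z,z^{-1}]]$, $v\mapsto Y(v,z)=\sum_{n\in\mathbb{Z}}v_nz^{-n-1}$, such that: (1) for $u,v\in V$, $u_nv=0$ for $n\gg0$; (2) $Y(\mathbf 1,z)=\mathrm{id}_V$ and $Y(v,z)\mathbf 1=v+(v_{-2}\mathbf 1)z+\cdots\in V[[z]]$; (3) $u_nv\in V_{\alpha+\beta}$ for $u\in V_\alpha$, $v\in V_\beta$, $n\in\mathbb{Z}$; (4) for homogeneous $u,v,w$, $$z_0^{-1}\delta\left(\tfrac{z_1-z_2}{z_0}\right)Y(u,z_1)Y(v,z_2)w-(-1)^{|u||v|}z_0^{-1}\delta\left(\tfrac{z_2-z_1}{-z_0}\right)Y(v,z_2)Y(u,z_1)w=z_2^{-1}\delta\left(\tfrac{z_1-z_0}{z_2}\right)Y(Y(u,z_0)v,z_2)w,$$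 where $\delta(z)=\sum_{n\in\mathbb{Z}}z^n$ and binomial powers are expanded in nonnegative powers of the second variable. A $\frac1T\mathbb{N}$-graded vertex superalgebra is a vertex superalgebra with a grading $V=\bigoplus_{n\in\frac1T\mathbb{N}}V_n$ such that $\mathbf 1\in V_0$; $V_\alpha=\bigoplus_n(V_\alpha\cap V_n)$ for $\alpha\in\mathbb{Z}_2$; and $u_sV_n\subseteq V_{n+m-s-1}$ for $u\in V_m$, $s\in\mathbb{Z}$, $m,n\in\frac1T\mathbb{N}$. For $v\in V_n$ write $\deg v=n$. An element is $(\mathbb{Z}_2\times\frac1T\mathbb{N})$-homogeneous if it lies in some $V_\alpha\cap V_n$. $V$ is strongly generated by a subset $U$ if $V$ is spanned by the elements $u^1_{-n_1}\cdots u^r_{-n_r}\mathbf 1$ with $r\ge0$, $u^i\in U$, $n_i\ge1$. Let $V$ be a $\frac1T\mathbb{N}$-graded vertex superalgebra strongly generated by a $\frac1T\mathbb{N}$-graded subsuperspace $U$. For $p\in\frac1T\mathbb{N}$ let $E_p(V)$ be the span of the vectors $u^1_{-n_1}\cdots u^r_{-n_r}\mathbf 1$ with $r\ge0$, $n_i\ge1$, and $u^1,\dots,u^r\in U$ $(\mathbb{Z}_2\times\frac1T\mathbb{N})$-homogeneous with $\deg u^1+\cdots+\deg u^r\le p$; put $E_p(V)=0$ for $p<0$. This is an increasing exhaustive filtration, and $$\mathrm{gr}_E(V)=\bigoplus_{p\in\frac1T\mathbb{N}}E_p(V)/E_{p-\frac1T}(V)$$ is a commutative vertex superalgebra with vacuum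 $\mathbf 1+E_{-\frac1T}(V)$ and products $(u+E_{p-\frac1T}(V))_n(v+E_{q-\frac1T}(V))=u_nv+E_{p+q-\frac1T}(V)$ for $u\in E_p(V)$, $v\in E_q(V)$, $n\in\mathbb{Z}$. For a vector superspace $\mathfrak h$, let $\mathcal F(\mathfrak h)=\mathcal U(\mathfrak h\otimes t^{-1}\mathbb{C}[t^{-1}])$ be the universal enveloping algebra of the commutative Lie superalgebra $\mathfrak h\otimes t^{-1}\mathbb{C}[t^{-1}]$ (parity inherited from $\mathfrak h$), i.e. the free supercommutative associative superalgebra on it. Write $h(-n)=h\otimes t^{-n}$, and let $\partial$ be the even derivation of $\mathcal F(\mathfrak h)$ with $\partial(h(-n))=n\,h(-n-1)$ for $h\in\mathfrak h$, $n>0$. Then $(\mathcal F(\mathfrak h),\partial)$ is a commutative vertex superalgebra with vacuum $1$ and $Y(a,z)b=(e^{z\partial}a)b$. $V$ (strongly generated by a $\frac1T\mathbb{N}$-graded subsuperspace $U$, from which $\mathrm{gr}_E(V)$ is built) admits a PBW basis if there is a vector superspace $\mathfrak h$ such that $\mathrm{gr}_E(V)\cong(\mathcal F(\mathfrak h),\partial)$ as commutative vertex superalgebras. *)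

theory Defs
  imports Complex_Main "HOL-Library.Poly_Mapping" "HOL-Library.Z2" "HOL-Library.FuncSet"
begin

section \<open>Direct sums, quotients, superspaces\<close>

definition (in module) direct_sum :: "'i set \<Rightarrow> ('i \<Rightarrow> 'b set) \<Rightarrow> 'b set \<Rightarrow> bool" where
  "direct_sum I S W \<longleftrightarrow> subspace W \<and> (\<forall>i\<in>I. subspace (S i) \<and> S i \<subseteq> W) \<and>
     (\<forall>w\<in>W. \<exists>!f. (\<forall>i\<in>I. f i \<in> S i) \<and> (\<forall>i. i \<notin> I \<longrightarrow> f i = 0) \<and>
        finite {i. f i \<noteq> 0} \<and> w = (\<Sum>i | f i \<noteq> 0. f i))"

definition coset :: "'a::ab_group_add set \<Rightarrow> 'a \<Rightarrow> 'a set" where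
  "coset W x = {x + w | w. w \<in> W}"

text \<open>Operations on quotients are computed on chosen representatives.\<close>

definition rep :: "'a set \<Rightarrow> 'a" where
  "rep A = (SOME x. x \<in> A)"

text \<open>The type \<open>bit\<close> is the two-element field, used as index set \<open>\<int>\<^sub>2\<close>.\<close>

locale superspace = vector_space scale
  for scale :: "complex \<Rightarrow> 'v::ab_group_add \<Rightarrow> 'v" +
  fixes par :: "bit \<Rightarrow> 'v set"
  assumes par_sum: "direct_sum UNIV par UNIV"

definition koszul :: "bit \<Rightarrow> bit \<Rightarrow> complex" where
  "koszul \<alpha> \<beta> = (if \<alpha> = 1 \<and> \<beta> = 1 then -1 else 1)"


section \<open>Vertex superalgebras\<close>

text \<open>The coefficient of \<open>x\<^sup>r y\<^sup>s z\<^sup>t\<close> in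
  \<open>z\<^sup>-\<^sup>1 \<delta>((x - y)/z) = (\<Sum>k\<in>\<int>. (x - y)\<^sup>k z\<^sup>-\<^sup>k\<^sup>-\<^sup>1)\<close>, where \<open>(x - y)\<^sup>k\<close> is expanded in
  nonnegative powers of \<open>y\<close>.\<close>

definition delta_coeff :: "int \<Rightarrow> int \<Rightarrow> int \<Rightarrow> complex" where
  "delta_coeff r s t =
     (if 0 \<le> s \<and> r + s = - t - 1 then (-1) ^ nat s * (of_int (r + s) gchoose nat s) else 0)"

text \<open>\<open>mode u n v\<close> is \<open>u\<^sub>n v\<close>, so the coefficient of \<open>z\<^sup>k\<close> in \<open>Y(u,z)v\<close> is \<open>mode u (- k - 1) v\<close>.
  The assumption \<open>jacobi\<close> compares the coefficients of \<open>z\<^sub>0\<^sup>a z\<^sub>1\<^sup>b z\<^sub>2\<^sup>c\<close> in the Jacobi identity; each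
  sum is a Cauchy product of a delta function with an iterated vertex operator, and has only
  finitely many nonzero terms by \<open>truncation\<close>. The factor \<open>(-1) powi (- a - 1)\<close> comes from
  \<open>-z\<^sub>0\<close> in the denominator of the second delta function.\<close>

locale vertex_superalgebra = superspace scale par
  for scale :: "complex \<Rightarrow> 'v::ab_group_add \<Rightarrow> 'v" and par +
  fixes vac :: 'v and mode :: "'v \<Rightarrow> int \<Rightarrow> 'v \<Rightarrow> 'v"
  assumes vac_even: "vac \<in> par 0"
    and mode_linear_left: "Vector_Spaces.linear scale scale (\<lambda>u. mode u n v)"
    and mode_linear_right: "Vector_Spaces.linear scale scale (\<lambda>v. mode u n v)"
    and truncation: "\<exists>N. \<forall>n\<ge>N. mode u n v = 0"
    and vac_mode: "mode vac n v = (if n = -1 then v else 0)"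
    and mode_vac: "n \<ge> 0 \<Longrightarrow> mode v n vac = 0" "mode v (-1) vac = v"
    and mode_par: "u \<in> par \<alpha> \<Longrightarrow> v \<in> par \<beta> \<Longrightarrow> mode u n v \<in> par (\<alpha> + \<beta>)"
    and jacobi: "u \<in> par \<alpha> \<Longrightarrow> v \<in> par \<beta> \<Longrightarrow> w \<in> par \<gamma> \<Longrightarrow>
        Sum_any (\<lambda>(b', c'). scale (delta_coeff b' c' a)
            (mode u (- (b - b') - 1) (mode v (- (c - c') - 1) w)))
        - scale (koszul \<alpha> \<beta>)
            (Sum_any (\<lambda>(b', c'). scale ((-1) powi (- a - 1) * delta_coeff c' b' a)
              (mode v (- (c - c') - 1) (mode u (- (b - b') - 1) w))))
        = Sum_any (\<lambda>(a', c'). scale (delta_coeff b a' c')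
            (mode (mode u (- (a - a') - 1) v) (- (c - c') - 1) w))"
begin

text \<open>\<open>monomial [(u\<^sub>1,n\<^sub>1),\<dots>,(u\<^sub>r,n\<^sub>r)]\<close> is the vector obtained from the vacuum by applying the
  modes of \<open>u\<^sub>1,\<dots>,u\<^sub>r\<close> of index \<open>-n\<^sub>1,\<dots>,-n\<^sub>r\<close>, the last one first.\<close>

definition monomial :: "('v \<times> nat) list \<Rightarrow> 'v" where
  "monomial ws = foldr (\<lambda>(u, n) x. mode u (- int n) x) ws vac"

definition strongly_generated_by :: "'v set \<Rightarrow> bool" where
  "strongly_generated_by U \<longleftrightarrow>
     span {monomial ws | ws. \<forall>(u, n) \<in> set ws. u \<in> U \<and> n \<ge> 1} = UNIV"

end

definition fracN :: "nat \<Rightarrow> rat set" where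
  "fracN T = {of_nat k / of_nat T | k. True}"

text \<open>By convention \<open>deg n = 0\<close> for \<open>n\<close> outside \<open>(1/T)\<nat>\<close>, which gives \<open>mode_deg\<close> its meaning
  when the degree on the right is negative.\<close>

locale graded_vertex_superalgebra = vertex_superalgebra scale par vac mode
  for scale :: "complex \<Rightarrow> 'v::ab_group_add \<Rightarrow> 'v" and par vac mode +
  fixes T :: nat and deg :: "rat \<Rightarrow> 'v set"
  assumes T_pos: "T > 0"
    and deg_outside: "n \<notin> fracN T \<Longrightarrow> deg n = {0}"
    and deg_sum: "direct_sum (fracN T) deg UNIV"
    and vac_deg: "vac \<in> deg 0"
    and par_deg_sum: "direct_sum (fracN T) (\<lambda>n. par \<alpha> \<inter> deg n) (par \<alpha>)"
    and mode_deg: "m \<in> fracN T \<Longrightarrow> n \<in> fracN T \<Longrightarrow> u \<in> deg m \<Longrightarrow> v \<in> deg n \<Longrightarrow>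
        mode u s v \<in> deg (n + m - of_int s - 1)"


section \<open>Isomorphisms\<close>

text \<open>The underlying data of a vertex superalgebra on an explicit carrier, needed because the
  quotient spaces below depend on parameters.\<close>

record 'a vsa =
  carrier :: "'a set"
  add :: "'a \<Rightarrow> 'a \<Rightarrow> 'a"
  smult :: "complex \<Rightarrow> 'a \<Rightarrow> 'a"
  part :: "bit \<Rightarrow> 'a set"
  vacuum :: 'a
  product :: "'a \<Rightarrow> int \<Rightarrow> 'a \<Rightarrow> 'a"

definition vsa_iso :: "'a vsa \<Rightarrow> 'b vsa \<Rightarrow> ('a \<Rightarrow> 'b) \<Rightarrow> bool" where
  "vsa_iso A B \<phi> \<longleftrightarrow>
     bij_betw \<phi> (carrier A) (carrier B) \<and>
     (\<forall>x\<in>carrier A. \<forall>y\<in>carrier A. \<phi> (add A x y) = add B (\<phi> x) (\<phi> y)) \<and>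
     (\<forall>c. \<forall>x\<in>carrier A. \<phi> (smult A c x) = smult B c (\<phi> x)) \<and>
     (\<forall>\<alpha>. \<phi> ` part A \<alpha> = part B \<alpha>) \<and>
     \<phi> (vacuum A) = vacuum B \<and>
     (\<forall>x\<in>carrier A. \<forall>y\<in>carrier A. \<forall>n. \<phi> (product A x n y) = product B (\<phi> x) n (\<phi> y))"

definition vsa_isomorphic :: "'a vsa \<Rightarrow> 'b vsa \<Rightarrow> bool" where
  "vsa_isomorphic A B \<longleftrightarrow> (\<exists>\<phi>. vsa_iso A B \<phi>)"


section \<open>The associated graded algebra\<close>

context graded_vertex_superalgebra
begin

definition graded_subsuperspace :: "'v set \<Rightarrow> bool" where
  "graded_subsuperspace U \<longleftrightarrow>
     direct_sum UNIV (\<lambda>\<alpha>. U \<inter> par \<alpha>) U \<and> direct_sum (fracN T) (\<lambda>n. U \<inter> deg n) U"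

text \<open>A list entry \<open>(u, d, n)\<close> is a homogeneous generator \<open>u\<close> of degree \<open>d\<close> with mode index
  \<open>-n\<close>. For \<open>p < 0\<close> no list qualifies, so \<open>filt U p = {0}\<close>.\<close>

definition filt :: "'v set \<Rightarrow> rat \<Rightarrow> 'v set" where
  "filt U p = span {monomial (map (\<lambda>(u, d, n). (u, n)) ws) | ws.
     (\<forall>(u, d, n) \<in> set ws. n \<ge> 1 \<and> u \<in> U \<and> d \<in> fracN T \<and> u \<in> deg d \<and> (\<exists>\<alpha>. u \<in> par \<alpha>)) \<and>
     sum_list (map (\<lambda>(u, d, n). d) ws) \<le> p}"

abbreviation filt_pred :: "'v set \<Rightarrow> rat \<Rightarrow> 'v set" where
  "filt_pred U p \<equiv> filt U (p - 1 / of_nat T)"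

text \<open>An element of the direct sum is a function assigning to each \<open>p \<in> (1/T)\<nat>\<close> a coset in
  \<open>filt U p / filt U (p - 1/T)\<close>, almost always zero.\<close>

definition gr_carrier :: "'v set \<Rightarrow> (rat \<Rightarrow> 'v set) set" where
  "gr_carrier U =
     {f \<in> (\<Pi>\<^sub>E p\<in>fracN T. coset (filt_pred U p) ` filt U p).
        finite {p \<in> fracN T. f p \<noteq> coset (filt_pred U p) 0}}"

definition gr :: "'v set \<Rightarrow> (rat \<Rightarrow> 'v set) vsa" where
  "gr U = \<lparr>
     carrier = gr_carrier U,
     add = (\<lambda>f g. \<lambda>p\<in>fracN T. coset (filt_pred U p) (rep (f p) + rep (g p))),
     smult = (\<lambda>c f. \<lambda>p\<in>fracN T. coset (filt_pred U p) (scale c (rep (f p)))),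
     part = (\<lambda>\<alpha>. {f \<in> gr_carrier U.
        \<forall>p\<in>fracN T. f p \<in> coset (filt_pred U p) ` (filt U p \<inter> par \<alpha>)}),
     vacuum = (\<lambda>p\<in>fracN T. coset (filt_pred U p) (if p = 0 then vac else 0)),
     product = (\<lambda>f n g. \<lambda>r\<in>fracN T. coset (filt_pred U r)
        (\<Sum>(p, q) | p \<in> fracN T \<and> q \<in> fracN T \<and> p + q = r. mode (rep (f p)) n (rep (g q))))
   \<rparr>"

end


section \<open>Free vector spaces and free algebras\<close>

definition fscale :: "complex \<Rightarrow> ('x \<Rightarrow>\<^sub>0 complex) \<Rightarrow> ('x \<Rightarrow>\<^sub>0 complex)" where
  "fscale c p = Poly_Mapping.map ((*) c) p"

lemma lookup_fscale [simp]:
  "Poly_Mapping.lookup (fscale c p) x = c * Poly_Mapping.lookup p x"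
  by (simp add: fscale_def map.rep_eq when_def)

lemma vector_space_fscale: "vector_space fscale"
  by unfold_locales (auto intro!: poly_mapping_eqI simp: lookup_add algebra_simps)

text \<open>Words form a monoid under concatenation, written additively so that
  \<open>'a word \<Rightarrow>\<^sub>0 complex\<close> with its library multiplication is the free associative unital algebra
  on \<open>'a\<close>.\<close>

datatype 'a word = Word (letters: "'a list")

instantiation word :: (type) monoid_add
begin

definition zero_word :: "'a word" where "0 = Word []"

definition plus_word :: "'a word \<Rightarrow> 'a word \<Rightarrow> 'a word" where
  "v + w = Word (letters v @ letters w)"

instance
  by standard (simp_all add: zero_word_def plus_word_def)

end

inductive_set two_sided_ideal :: "'a::ring_1 set \<Rightarrow> 'a set" for R where
  zero: "0 \<in> two_sided_ideal R"
| base: "r \<in> R \<Longrightarrow> a * r * b \<in> two_sided_ideal R"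
| sum: "x \<in> two_sided_ideal R \<Longrightarrow> y \<in> two_sided_ideal R \<Longrightarrow> x + y \<in> two_sided_ideal R"


section \<open>The commutative vertex superalgebra \<open>\<F>(\<hh>)\<close>\<close>

text \<open>The letter \<open>(h, k)\<close> stands for \<open>h(-k-1) = h \<otimes> t\<^sup>-\<^sup>k\<^sup>-\<^sup>1\<close>, so that all \<open>k :: nat\<close> are
  admissible.\<close>

type_synonym 'h free = "('h \<times> nat) word \<Rightarrow>\<^sub>0 complex"

definition gen :: "'h \<Rightarrow> nat \<Rightarrow> 'h free" where
  "gen h k = Poly_Mapping.single (Word [(h, k)]) 1"

text \<open>The first two sets of relations turn the free algebra on the letters into the tensor algebra of
  \<open>\<hh> \<otimes> t\<^sup>-\<^sup>1\<complex>[t\<^sup>-\<^sup>1]\<close>; the third one gives its universal enveloping algebra, all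
  superbrackets being zero.\<close>

definition fock_relations ::
  "(complex \<Rightarrow> 'h::ab_group_add \<Rightarrow> 'h) \<Rightarrow> (bit \<Rightarrow> 'h set) \<Rightarrow> 'h free set" where
  "fock_relations hscale hpar =
     {gen (x + y) k - gen x k - gen y k | x y k. True} \<union>
     {gen (hscale c x) k - fscale c (gen x k) | c x k. True} \<union>
     {gen x k * gen y l - fscale (koszul \<alpha> \<beta>) (gen y l * gen x k) | x y k l \<alpha> \<beta>.
        x \<in> hpar \<alpha> \<and> y \<in> hpar \<beta>}"

definition fock_ideal ::
  "(complex \<Rightarrow> 'h::ab_group_add \<Rightarrow> 'h) \<Rightarrow> (bit \<Rightarrow> 'h set) \<Rightarrow> 'h free set" where
  "fock_ideal hscale hpar = two_sided_ideal (fock_relations hscale hpar)"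

text \<open>The derivation \<open>\<partial>\<close> with \<open>\<partial>(h(-n)) = n h(-n-1)\<close>, i.e. sending \<open>gen h k\<close> to
  \<open>(k + 1) gen h (k + 1)\<close>; first on words by the Leibniz rule, then linearly.\<close>

primrec deriv_word :: "('h \<times> nat) list \<Rightarrow> 'h free" where
  "deriv_word [] = 0"
| "deriv_word (x # xs) =
     fscale (of_nat (snd x + 1)) (gen (fst x) (snd x + 1)) * Poly_Mapping.single (Word xs) 1
     + gen (fst x) (snd x) * deriv_word xs"

definition free_deriv :: "'h free \<Rightarrow> 'h free" where
  "free_deriv p =
     (\<Sum>w\<in>Poly_Mapping.keys p. fscale (Poly_Mapping.lookup p w) (deriv_word (letters w)))"

text \<open>The span of the words in homogeneous letters whose parities add up to \<open>\<alpha>\<close>.\<close>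

definition free_part :: "(bit \<Rightarrow> 'h set) \<Rightarrow> bit \<Rightarrow> 'h free set" where
  "free_part hpar \<alpha> = module.span fscale
     {Poly_Mapping.single (Word xs) 1 | xs.
        \<exists>\<beta>s. list_all2 (\<lambda>x \<beta>. fst x \<in> hpar \<beta>) xs \<beta>s \<and> sum_list \<beta>s = \<alpha>}"

text \<open>From \<open>Y(a,z)b = (e\<^sup>z\<^sup>\<partial> a)b\<close>: for \<open>n < 0\<close> and \<open>k = -n-1\<close>, \<open>a\<^sub>n b = (\<partial>\<^sup>k a / k!) b\<close>.\<close>

definition fock ::
  "(complex \<Rightarrow> 'h::ab_group_add \<Rightarrow> 'h) \<Rightarrow> (bit \<Rightarrow> 'h set) \<Rightarrow> 'h free set vsa" where
  "fock hscale hpar = (let q = coset (fock_ideal hscale hpar) in \<lparr>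
     carrier = range q,
     add = (\<lambda>A B. q (rep A + rep B)),
     smult = (\<lambda>c A. q (fscale c (rep A))),
     part = (\<lambda>\<alpha>. q ` free_part hpar \<alpha>),
     vacuum = q 1,
     product = (\<lambda>A n B. if n \<ge> 0 then q 0 else
        (let k = nat (- n - 1) in
          q (fscale (1 / fact k) ((free_deriv ^^ k) (rep A)) * rep B)))
   \<rparr>)"


section \<open>PBW bases\<close>

text \<open>HOL cannot quantify over types inside a formula, so the type underlying \<open>\<hh>\<close> is a parameter;
  the vector superspace structure on it is existentially quantified.\<close>

definition (in graded_vertex_superalgebra) admits_PBW_basis :: "'h::ab_group_add itself \<Rightarrow> bool"
  where
  "admits_PBW_basis (_ :: 'h itself) \<longleftrightarrow>
     (\<exists>U. graded_subsuperspace U \<and> strongly_generated_by U \<and>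
       (\<exists>(hscale :: complex \<Rightarrow> 'h \<Rightarrow> 'h) hpar.
          superspace hscale hpar \<and> vsa_isomorphic (gr U) (fock hscale hpar)))"


section \<open>The map \<open>Y(z)\<close> on the tensor product\<close>

abbreviation pure :: "'a \<times> 'b \<Rightarrow> ('a \<times> 'b \<Rightarrow>\<^sub>0 complex)" where
  "pure x \<equiv> Poly_Mapping.single x 1"

definition tensor_relations ::
  "(complex \<Rightarrow> 'a::ab_group_add \<Rightarrow> 'a) \<Rightarrow> (complex \<Rightarrow> 'b::ab_group_add \<Rightarrow> 'b) \<Rightarrow>
     ('a \<times> 'b \<Rightarrow>\<^sub>0 complex) set" where
  "tensor_relations s1 s2 =
     {pure (u + u', v) - pure (u, v) - pure (u', v) | u u' v. True} \<union>
     {pure (u, v + v') - pure (u, v) - pure (u, v') | u v v'. True} \<union>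
     {pure (s1 c u, v) - fscale c (pure (u, v)) | c u v. True} \<union>
     {pure (u, s2 c v) - fscale c (pure (u, v)) | c u v. True}"

definition tensor_coset ::
  "(complex \<Rightarrow> 'a::ab_group_add \<Rightarrow> 'a) \<Rightarrow> (complex \<Rightarrow> 'b::ab_group_add \<Rightarrow> 'b) \<Rightarrow>
     ('a \<times> 'b \<Rightarrow>\<^sub>0 complex) \<Rightarrow> ('a \<times> 'b \<Rightarrow>\<^sub>0 complex) set" where
  "tensor_coset s1 s2 = coset (module.span fscale (tensor_relations s1 s2))"

definition tensor_product ::
  "(complex \<Rightarrow> 'a::ab_group_add \<Rightarrow> 'a) \<Rightarrow> (complex \<Rightarrow> 'b::ab_group_add \<Rightarrow> 'b) \<Rightarrow>
     ('a \<times> 'b \<Rightarrow>\<^sub>0 complex) set set" where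
  "tensor_product s1 s2 = range (tensor_coset s1 s2)"

text \<open>A Laurent series in \<open>V((z))\<close> is its coefficient function, supported on a set of exponents
  bounded below.\<close>

definition laurent_series :: "(int \<Rightarrow> 'v::zero) set" where
  "laurent_series = {f. \<exists>N. \<forall>k<N. f k = 0}"

context vertex_superalgebra
begin

definition Y_map :: "'v \<Rightarrow> 'v \<Rightarrow> int \<Rightarrow> 'v" where
  "Y_map u v k = mode u (- k - 1) v"

definition Y_free :: "('v \<times> 'v \<Rightarrow>\<^sub>0 complex) \<Rightarrow> int \<Rightarrow> 'v" where
  "Y_free p k = (\<Sum>x\<in>Poly_Mapping.keys p.
     scale (Poly_Mapping.lookup p x) (Y_map (fst x) (snd x) k))"

definition Y_tensor :: "('v \<times> 'v \<Rightarrow>\<^sub>0 complex) set \<Rightarrow> int \<Rightarrow> 'v" where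
  "Y_tensor A = Y_free (rep A)"

lemma Y_free_eq:
  assumes "finite S" "Poly_Mapping.keys p \<subseteq> S"
  shows "Y_free p k = (\<Sum>x\<in>S. scale (Poly_Mapping.lookup p x) (Y_map (fst x) (snd x) k))"
  unfolding Y_free_def
  by (rule sum.mono_neutral_left) (use assms in \<open>auto simp: in_keys_iff\<close>)

lemma Y_free_add: "Y_free (p + q) k = Y_free p k + Y_free q k"
proof -
  let ?S = "Poly_Mapping.keys p \<union> Poly_Mapping.keys q"
  have "Poly_Mapping.keys (p + q) \<subseteq> ?S"
    by (rule Poly_Mapping.keys_add)
  then show ?thesis
    by (simp add: Y_free_eq[of ?S] lookup_add scale_left_distrib sum.distrib)
qed

lemma Y_free_fscale: "Y_free (fscale c p) k = scale c (Y_free p k)"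
proof -
  have "Poly_Mapping.keys (fscale c p) \<subseteq> Poly_Mapping.keys p"
    by (auto simp: in_keys_iff)
  then show ?thesis
    by (simp add: Y_free_eq[of "Poly_Mapping.keys p"] scale_sum_right)
qed

lemma Y_free_diff: "Y_free (p - q) k = Y_free p k - Y_free q k"
  using Y_free_add[of "p - q" q k] by simp

lemma Y_free_pure: "Y_free (pure (u, v)) k = Y_map u v k"
  by (simp add: Y_free_def)

lemma Y_free_relations:
  assumes "p \<in> module.span fscale (tensor_relations scale scale)"
  shows "Y_free p k = 0"
proof -
  interpret F: vector_space fscale by (rule vector_space_fscale)
  have [simp]: "mode (u + u') n v = mode u n v + mode u' n v"
    "mode u n (v + v') = mode u n v + mode u n v'"
    "mode (scale c u) n v = scale c (mode u n v)"
    "mode u n (scale c v) = scale c (mode u n v)" for u u' v v' n c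
    using mode_linear_left[of n v] mode_linear_right[of u n]
    by (simp_all add: module_hom_iff_linear[symmetric] module_hom_iff)
  have "F.subspace {p. Y_free p k = 0}"
    by (rule F.subspaceI) (simp_all add: Y_free_add Y_free_fscale, simp add: Y_free_def)
  moreover have "tensor_relations scale scale \<subseteq> {p. Y_free p k = 0}"
    by (auto simp: tensor_relations_def Y_free_diff Y_free_fscale Y_free_pure Y_map_def)
  ultimately show ?thesis
    using assms F.span_minimal by blast
qed

lemma Y_tensor_coset: "Y_tensor (tensor_coset scale scale p) = Y_free p"
proof
  fix k
  interpret F: vector_space fscale by (rule vector_space_fscale)
  let ?K = "F.span (tensor_relations scale scale)"
  have "p + 0 \<in> coset ?K p"
    unfolding coset_def using F.span_zero by blast
  then have "rep (coset ?K p) \<in> coset ?K p"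
    unfolding rep_def by (rule someI)
  then obtain w where "w \<in> ?K" "rep (coset ?K p) = p + w"
    unfolding coset_def by blast
  then show "Y_tensor (tensor_coset scale scale p) k = Y_free p k"
    by (simp add: Y_tensor_def tensor_coset_def Y_free_add Y_free_relations)
qed

lemma Y_tensor_pure: "Y_tensor (tensor_coset scale scale (pure (u, v))) = Y_map u v"
  by (simp add: Y_tensor_coset Y_free_pure fun_eq_iff)

lemma Y_map_laurent: "Y_map u v \<in> laurent_series"
proof -
  obtain N where N: "\<forall>n\<ge>N. mode u n v = 0"
    using truncation by blast
  have "\<forall>k < - N. Y_map u v k = 0"
    using N by (simp add: Y_map_def)
  then show ?thesis
    unfolding laurent_series_def by blast
qed

lemma Y_tensor_laurent: "Y_tensor ` tensor_product scale scale \<subseteq> laurent_series"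
proof -
  have "Y_free p \<in> laurent_series" for p
  proof -
    have "\<exists>N. \<forall>k<N. Y_map (fst x) (snd x) k = 0" for x
      using Y_map_laurent unfolding laurent_series_def by blast
    then obtain N where N: "\<And>x k. k < N x \<Longrightarrow> Y_map (fst x) (snd x) k = 0"
      by metis
    define M where "M = Min (insert 0 (N ` Poly_Mapping.keys p))"
    have "M \<le> N x" if "x \<in> Poly_Mapping.keys p" for x
      unfolding M_def using that by (intro Min_le) auto
    then have "\<forall>k<M. Y_free p k = 0"
      unfolding Y_free_def using N by (fastforce intro!: sum.neutral)
    then show ?thesis
      unfolding laurent_series_def by blast
  qed
  then show ?thesis
    by (auto simp: tensor_product_def Y_tensor_coset)
qed

end

end

theory Submission
  imports Defs
    "HOL-Computational_Algebra.Polynomial_Factorial"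
    "HOL-Computational_Algebra.Field_as_Ring"
    "HOL-Complex_Analysis.Cauchy_Integral_Formula"
begin

text \<open>View the elements of \<open>\<F>(\<hh>)\<close> as functions of generic power series
  \<open>h(x) = (\<Sum>k. h(-k-1) x\<^sup>k)\<close>, one for each \<open>h\<close> in \<open>\<hh>\<close>; then \<open>e\<^sup>z\<^sup>\<partial>\<close> is the translation
  \<open>h(x) \<mapsto> h(x + z)\<close>. Replace \<open>h(x)\<close> by a polynomial in \<open>x\<close> with coefficients in
  \<open>\<F>(\<hh>) \<otimes> \<F>(\<hh>)\<close> whose jets of order \<open>N\<close> at \<open>x = 1\<close> and \<open>x = 0\<close> are those of \<open>h(x) \<otimes> 1\<close> (in
  \<open>x - 1\<close>) and \<open>1 \<otimes> h(x)\<close>. At \<open>z = 1\<close> the element \<open>(e\<^sup>z\<^sup>\<partial>a)b\<close> becomes \<open>a \<otimes> b\<close> if \<open>a\<close> and \<open>b\<close> only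
  involve the first \<open>N\<close> modes, so \<open>Y(z)\<close> is injective on \<open>\<F>(\<hh>)\<close>.

  In \<open>V\<close>, the terms of highest filtration degree of an element of the kernel of \<open>Y(z)\<close> give an
  element of the kernel for \<open>gr\<^sub>E(V) \<cong> \<F>(\<hh>)\<close>, hence vanish. Products are compatible with the
  filtration because the modes \<open>a\<^sub>j\<close> with \<open>j \<ge> 0\<close> of a generator of degree \<open>d\<close> raise the
  filtration degree by at most \<open>d - 1\<close>.\<close>

section \<open>Components in direct sums\<close>

text \<open>\<open>\<F>(\<hh>)\<close> is a quotient of a free algebra, and its tensor square is
  never built. Instead, linear functionals killing the ideal are fixed and the substitution is
  transposed onto them. There are enough functionals: a basis of V adapted to the filtration yields
  a dual coordinate form for each of its members. Pairing with functionals is also what makes z = 1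
  meaningful: the formal series becomes an entire function of z whose derivatives at 0 are the given
  products. Interpolation at two points is forced, because the modes at 1 and at 0 must be free of
  each other while one polynomial has to connect them. In V the obstacle is that products in
  \<open>gr\<close> are computed on chosen representatives, so every mode, of either sign, must
  respect the filtration. Commutators produce vectors a_i b that are not given as monomials in
  generators. They are controlled by the grading: V_m \<subseteq> E_m, because the degree of a
  monomial is at least the sum of the degrees of its generators.\<close>

definition (in module) component :: "'i set \<Rightarrow> ('i \<Rightarrow> 'b set) \<Rightarrow> 'b \<Rightarrow> 'i \<Rightarrow> 'b" where
  "component I S w = (THE f. (\<forall>i\<in>I. f i \<in> S i) \<and> (\<forall>i. i \<notin> I \<longrightarrow> f i = 0) \<and>
        finite {i. f i \<noteq> 0} \<and> w = (\<Sum>i | f i \<noteq> 0. f i))"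

context module
begin

lemma component:
  assumes "direct_sum I S W" "w \<in> W"
  shows component_in: "i \<in> I \<Longrightarrow> component I S w i \<in> S i"
    and component_outside: "i \<notin> I \<Longrightarrow> component I S w i = 0"
    and finite_component: "finite {i. component I S w i \<noteq> 0}"
    and Sum_any_component: "Sum_any (component I S w) = w"
proof -
  have "\<exists>!f. (\<forall>i\<in>I. f i \<in> S i) \<and> (\<forall>i. i \<notin> I \<longrightarrow> f i = 0) \<and>
        finite {i. f i \<noteq> 0} \<and> w = (\<Sum>i | f i \<noteq> 0. f i)"
    using assms(1,2) unfolding direct_sum_def by blast
  note c = theI'[OF this, folded component_def]
  from c show "i \<in> I \<Longrightarrow> component I S w i \<in> S i" "i \<notin> I \<Longrightarrow> component I S w i = 0"
    "finite {i. component I S w i \<noteq> 0}"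
    by blast+
  from c show "Sum_any (component I S w) = w"
    unfolding Sum_any.expand_set by (elim conjE) (erule sym)
qed

lemma component_unique:
  assumes "direct_sum I S W" "w \<in> W"
    and "\<And>i. i \<in> I \<Longrightarrow> f i \<in> S i" "\<And>i. i \<notin> I \<Longrightarrow> f i = 0"
    and "finite {i. f i \<noteq> 0}" "Sum_any f = w"
  shows "component I S w = f"
proof -
  have "\<exists>!f. (\<forall>i\<in>I. f i \<in> S i) \<and> (\<forall>i. i \<notin> I \<longrightarrow> f i = 0) \<and>
        finite {i. f i \<noteq> 0} \<and> w = (\<Sum>i | f i \<noteq> 0. f i)"
    using assms(1,2) unfolding direct_sum_def by blast
  moreover have "w = (\<Sum>i | f i \<noteq> 0. f i)"
    unfolding assms(6)[symmetric] Sum_any.expand_set ..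
  ultimately show ?thesis
    unfolding component_def using assms(3-5) by (intro ext fun_cong[OF the1_equality]) auto
qed

lemma component_add:
  assumes "direct_sum I S W" "v \<in> W" "w \<in> W"
  shows "component I S (v + w) i = component I S v i + component I S w i"
proof -
  have S: "subspace (S i)" if "i \<in> I" for i
    using assms(1) that by (auto simp: direct_sum_def)
  have "component I S (v + w) = (\<lambda>i. component I S v i + component I S w i)"
  proof (rule component_unique[OF assms(1)])
    show "v + w \<in> W"
      using assms by (auto simp: direct_sum_def subspace_add)
    show "finite {i. component I S v i + component I S w i \<noteq> 0}"
      by (rule finite_subset[OF _ finite_UnI[OF finite_component[OF assms(1,2)]
            finite_component[OF assms(1,3)]]]) auto
    show "Sum_any (\<lambda>i. component I S v i + component I S w i) = v + w"
      by (simp add: Sum_any.distrib[OF finite_component[OF assms(1,2)] finite_component[OF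
        assms(1,3)]]
          Sum_any_component[OF assms(1,2)] Sum_any_component[OF assms(1,3)])
    show "component I S v i + component I S w i \<in> S i" if "i \<in> I" for i
      by (intro subspace_add S that component_in[OF assms(1,2)] component_in[OF assms(1,3)])
    show "component I S v i + component I S w i = 0" if "i \<notin> I" for i
      by (simp add: that component_outside[OF assms(1,2)] component_outside[OF assms(1,3)])
  qed
  then show ?thesis
    by simp
qed

lemma component_scale:
  assumes "direct_sum I S W" "w \<in> W"
  shows "component I S (scale c w) i = scale c (component I S w i)"
proof -
  have S: "subspace (S i)" if "i \<in> I" for i
    using assms(1) that by (auto simp: direct_sum_def)
  have sub: "{i. scale c (component I S w i) \<noteq> 0} \<subseteq> {i. component I S w i \<noteq> 0}"
    by auto
  have "component I S (scale c w) = (\<lambda>i. scale c (component I S w i))"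
  proof (rule component_unique[OF assms(1)])
    show "scale c w \<in> W"
      using assms by (auto simp: direct_sum_def subspace_scale)
    show "finite {i. scale c (component I S w i) \<noteq> 0}"
      by (rule finite_subset[OF sub finite_component[OF assms]])
    have "Sum_any (\<lambda>i. scale c (component I S w i)) =
        (\<Sum>i | component I S w i \<noteq> 0. scale c (component I S w i))"
      by (rule Sum_any.expand_superset[OF finite_component[OF assms] sub])
    also have "\<dots> = scale c (Sum_any (component I S w))"
      by (simp add: Sum_any.expand_set scale_sum_right)
    finally show "Sum_any (\<lambda>i. scale c (component I S w i)) = scale c w"
      by (simp add: Sum_any_component[OF assms])
    show "scale c (component I S w i) \<in> S i" if "i \<in> I" for i
      by (intro subspace_scale S that component_in[OF assms])
    show "scale c (component I S w i) = 0" if "i \<notin> I" for i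
      by (simp add: that component_outside[OF assms])
  qed
  then show ?thesis
    by simp
qed

lemma component_of_summand:
  assumes "direct_sum I S W" "w \<in> S j" "j \<in> I"
  shows "component I S w = (\<lambda>i. if i = j then w else 0)"
proof (rule component_unique[OF assms(1)])
  have sub: "subspace (S i)" "S i \<subseteq> W" if "i \<in> I" for i
    using assms(1) that by (auto simp: direct_sum_def)
  show "w \<in> W"
    using sub assms by blast
  show "Sum_any (\<lambda>i. if i = j then w else 0) = w"
    using Sum_any.expand_superset[of "{j}" "\<lambda>i. if i = j then w else 0"] by auto
  show "(if i = j then w else 0) \<in> S i" if "i \<in> I" for i
    using assms(2) sub(1)[OF that] by (auto simp: subspace_0)
  show "finite {i. (if i = j then w else 0) \<noteq> 0}"
    by (rule finite_subset[of _ "{j}"]) auto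
qed (use assms in auto)

end

lemma UNIV_bit: "(UNIV :: bit set) = {0, 1}"
proof -
  have "\<alpha> \<in> {0, 1}" for \<alpha> :: bit
    by (cases \<alpha>) simp_all
  then show ?thesis
    by blast
qed

lemma finite_UNIV_bit: "finite (UNIV :: bit set)"
  by (simp add: UNIV_bit)

lemma (in superspace) parity_decomposition:
  "component UNIV par v \<alpha> \<in> par \<alpha>"
  "component UNIV par v 0 + component UNIV par v 1 = v"
proof -
  show "component UNIV par v \<alpha> \<in> par \<alpha>"
    by (rule component_in[OF par_sum]) auto
  have "v = Sum_any (component UNIV par v)"
    by (simp add: Sum_any_component[OF par_sum])
  also have "\<dots> = (\<Sum>\<alpha>\<in>{0,1}. component UNIV par v \<alpha>)"
    by (rule Sum_any.expand_superset) (simp_all add: finite_UNIV_bit UNIV_bit[symmetric])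
  finally show "component UNIV par v 0 + component UNIV par v 1 = v"
    by simp
qed

section \<open>Linear extension from monomials of a free algebra\<close>

lemma poly_mapping_eq_sum_single:
  "p = (\<Sum>x\<in>Poly_Mapping.keys p. Poly_Mapping.single x (Poly_Mapping.lookup p x))"
proof (rule poly_mapping_eqI)
  fix i
  have "Poly_Mapping.lookup (\<Sum>x\<in>Poly_Mapping.keys p. Poly_Mapping.single x (Poly_Mapping.lookup p
    x)) i
    = (\<Sum>x\<in>Poly_Mapping.keys p. if x = i then Poly_Mapping.lookup p x else 0)"
    by (simp add: lookup_sum lookup_single when_def)
  then show "Poly_Mapping.lookup p i = Poly_Mapping.lookup
      (\<Sum>x\<in>Poly_Mapping.keys p. Poly_Mapping.single x (Poly_Mapping.lookup p x)) i"
    by (simp add: in_keys_iff)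
qed

lemma poly_mapping_additive_induct [case_names single add]:
  fixes p :: "'x \<Rightarrow>\<^sub>0 'c::comm_monoid_add"
  assumes "\<And>x c. P (Poly_Mapping.single x c)"
    and "\<And>p q. P p \<Longrightarrow> P q \<Longrightarrow> P (p + q)"
  shows "P p"
proof -
  have "P (\<Sum>x\<in>S. Poly_Mapping.single x (f x))" if "finite S" for S :: "'x set" and f
    using that
  proof induction
    case empty
    then show ?case using assms(1)[of undefined 0] by simp
  next
    case (insert x F)
    then show ?case
      by (simp add: assms)
  qed
  from this[of "Poly_Mapping.keys p" "Poly_Mapping.lookup p"] show ?thesis
    by (simp flip: poly_mapping_eq_sum_single)
qed

lemma fscale_single [simp]: "fscale c (Poly_Mapping.single x d) = Poly_Mapping.single x (c * d)"
  by (rule poly_mapping_eqI) (simp add: lookup_single when_def)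

lemma fscale_add: "fscale c (p + q) = fscale c p + fscale c q"
  by (rule poly_mapping_eqI) (simp add: lookup_add algebra_simps)

lemma fscale_mult_left: "fscale c p * q = fscale c (p * q)"
  and fscale_mult_right: "p * fscale c q = fscale c (p * q)"
proof -
  have 1: "fscale c (Poly_Mapping.single x d) * q = fscale c (Poly_Mapping.single x d * q)" for x d
    by (induction q rule: poly_mapping_additive_induct)
      (simp_all add: mult_single distrib_left fscale_add mult.assoc)
  show "fscale c p * q = fscale c (p * q)"
    by (induction p rule: poly_mapping_additive_induct)
      (simp_all add: 1 distrib_right fscale_add del: fscale_single)
  have 2: "Poly_Mapping.single x d * fscale c q = fscale c (Poly_Mapping.single x d * q)" for x d
    by (induction q rule: poly_mapping_additive_induct)
      (simp_all add: mult_single distrib_left fscale_add mult.left_commute)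
  show "p * fscale c q = fscale c (p * q)"
    by (induction p rule: poly_mapping_additive_induct)
      (simp_all add: 2 distrib_right fscale_add)
qed

definition lin :: "('x \<Rightarrow> complex) \<Rightarrow> ('x \<Rightarrow>\<^sub>0 complex) \<Rightarrow> complex" where
  "lin g p = (\<Sum>x\<in>Poly_Mapping.keys p. Poly_Mapping.lookup p x * g x)"

lemma lin_superset:
  assumes "finite S" "Poly_Mapping.keys p \<subseteq> S"
  shows "lin g p = (\<Sum>x\<in>S. Poly_Mapping.lookup p x * g x)"
  unfolding lin_def by (rule sum.mono_neutral_left) (use assms in \<open>auto simp: in_keys_iff\<close>)

lemma lin_add: "lin g (p + q) = lin g p + lin g q"
proof -
  let ?S = "Poly_Mapping.keys p \<union> Poly_Mapping.keys q"
  have "Poly_Mapping.keys (p + q) \<subseteq> ?S"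
    by (rule Poly_Mapping.keys_add)
  then show ?thesis
    by (simp add: lin_superset[of ?S] lookup_add algebra_simps sum.distrib)
qed

lemma lin_fscale: "lin g (fscale c p) = c * lin g p"
proof -
  have "Poly_Mapping.keys (fscale c p) \<subseteq> Poly_Mapping.keys p"
    by (auto simp: in_keys_iff)
  then show ?thesis
    by (simp add: lin_superset[of "Poly_Mapping.keys p"] sum_distrib_left mult.assoc)
qed

lemma lin_0 [simp]: "lin g 0 = 0"
  by (simp add: lin_def)

lemma lin_diff: "lin g (p - q) = lin g p - lin g q"
  using lin_add[of g "p - q" q] by simp

lemma lin_sum: "lin g (\<Sum>i\<in>S. f i) = (\<Sum>i\<in>S. lin g (f i))"
  by (induction S rule: infinite_finite_induct) (simp_all add: lin_add)

lemma lin_single [simp]: "lin g (Poly_Mapping.single x c) = c * g x"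
  by (simp add: lin_def lookup_single)

lemma lin_fun_cmult: "lin (\<lambda>x. c * g x) p = c * lin g p"
  by (simp add: lin_def sum_distrib_left mult.left_commute)

lemma lin_mult: "lin g (p * q) = lin (\<lambda>y. lin (\<lambda>x. g (x + y)) p) q"
proof (induction q rule: poly_mapping_additive_induct)
  case (single y d)
  show ?case
    by (induction p rule: poly_mapping_additive_induct)
      (simp_all add: mult_single distrib_right distrib_left lin_add mult.assoc mult.left_commute)
qed (simp add: distrib_left lin_add)

lemma lin_cong: "(\<And>x. x \<in> Poly_Mapping.keys p \<Longrightarrow> f x = g x) \<Longrightarrow> lin f p = lin g p"
  by (simp add: lin_def)

lemma lin_linear:
  assumes "\<And>p q. L (p + q) = L p + L q" "\<And>c p. L (fscale c p) = c * L p"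
  shows "lin (\<lambda>x. L (Poly_Mapping.single x 1)) p = L p"
proof (induction p rule: poly_mapping_additive_induct)
  case (single x c)
  show ?case
    using assms(2)[of c "Poly_Mapping.single x 1"] by simp
qed (simp add: lin_add assms(1))

lemma has_field_derivative_lin:
  assumes "\<And>x. ((\<lambda>s. g s x) has_field_derivative g' x) (at s)"
  shows "((\<lambda>s. lin (g s) p) has_field_derivative lin g' p) (at s)"
  unfolding lin_def by (intro DERIV_sum DERIV_cmult) (rule assms)

section \<open>Hermite interpolation at two points\<close>

text \<open>The coefficient of x^k in p(s + x), taken as a function of the base point s so that
  translation can be differentiated.\<close>

definition taylor_coeff :: "complex poly \<Rightarrow> nat \<Rightarrow> complex \<Rightarrow> complex" where
  "taylor_coeff p k s = poly ((pderiv ^^ k) p) s / fact k"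

lemma has_field_derivative_taylor_coeff:
  "(taylor_coeff p k has_field_derivative of_nat (Suc k) * taylor_coeff p (Suc k) s) (at s)"
proof -
  have "((\<lambda>s. poly ((pderiv ^^ k) p) s / fact k) has_field_derivative
      poly (pderiv ((pderiv ^^ k) p)) s / fact k) (at s)"
    by (intro DERIV_cdivide poly_DERIV)
  moreover have "poly (pderiv ((pderiv ^^ k) p)) s / fact k
    = of_nat (Suc k) * taylor_coeff p (Suc k) s"
    by (simp add: taylor_coeff_def divide_simps del: of_nat_Suc)
  ultimately show ?thesis
    by (simp add: taylor_coeff_def[abs_def] fun_eq_iff)
qed

lemma taylor_coeff_eq_coeff: "taylor_coeff p k a = coeff (pcompose p [:a, 1:]) k"
proof -
  have shift: "(pderiv ^^ k) (pcompose p [:a, 1:]) = pcompose ((pderiv ^^ k) p) [:a, 1:]"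
    by (induction k) (simp_all add: pderiv_pcompose pderiv_pCons)
  have "poly ((pderiv ^^ k) p) a = coeff (pcompose ((pderiv ^^ k) p) [:a, 1:]) 0"
    by (simp add: coeff_pcompose_0)
  also have "\<dots> = fact k * coeff (pcompose p [:a, 1:]) k"
    by (simp flip: shift add: coeff_higher_pderiv pochhammer_fact)
  finally show ?thesis
    by (simp add: taylor_coeff_def)
qed

lemma hermite_interpolation:
  fixes a b :: complex
  assumes "a \<noteq> b"
  obtains p where
    "\<And>m k. k < N \<Longrightarrow> taylor_coeff (p m) k a = (if k = m then 1 else 0)"
    "\<And>m k. k < N \<Longrightarrow> taylor_coeff (p m) k b = 0"
proof -
  let ?f = "[:- a, 1:] ^ N" and ?g = "[:- b, 1:] ^ N"
  have "coprime [:- a, 1:] [:- b, 1:]"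
  proof -
    have "[:- a, 1:] - [:- b, 1:] = [:b - a:]"
      by simp
    then have "is_unit ([:- a, 1:] - [:- b, 1:])"
      using assms by (simp add: is_unit_const_poly_iff dvd_field_iff)
    then show ?thesis
      by (meson coprimeI dvd_diff dvd_trans)
  qed
  then have "coprime ?f ?g"
    by simp
  then obtain u v where uv: "u * ?f + v * ?g = 1"
    by (metis bezout_coefficients_fst_snd coprime_imp_gcd_eq_1)
  \<comment> \<open>By Bezout, \<open>v * ?g\<close> is 1 modulo (x - a)^N and 0 modulo (x - b)^N.
    The factor (x - a)^m then moves the jet at a to order m.\<close>
  define p where "p m = [:- a, 1:] ^ m * v * ?g" for m
  have p: "p m = [:- a, 1:] ^ m - [:- a, 1:] ^ N * ([:- a, 1:] ^ m * u)" for m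
  proof -
    have "p m = [:- a, 1:] ^ m * (1 - u * ?f)"
      by (simp flip: uv add: p_def algebra_simps)
    then show ?thesis
      by (simp add: algebra_simps)
  qed
  have comp: "pcompose ([:- c, 1:] ^ n) [:c, 1:] = monom 1 n" for c :: complex and n
  proof -
    have "pcompose [:- c, 1:] [:c, 1:] = [:0, 1:]"
      by (simp add: pcompose_pCons)
    then have "pcompose ([:- c, 1:] ^ n) [:c, 1:] = [:0, 1:] ^ n"
      by (induction n) (simp_all add: pcompose_mult pcompose_1 del: mult_pCons_left)
    then show ?thesis
      by (simp add: monom_altdef)
  qed
  show thesis
  proof (rule that[of p])
    fix m k assume k: "k < N"
    show "taylor_coeff (p m) k a = (if k = m then 1 else 0)"
      using k by (simp add: taylor_coeff_eq_coeff p pcompose_diff pcompose_mult comp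
        coeff_monom_mult)
    have "pcompose (p m) [:b, 1:] = monom 1 N * pcompose ([:- a, 1:] ^ m * v) [:b, 1:]"
      by (simp add: p_def pcompose_mult comp mult.commute)
    then show "taylor_coeff (p m) k b = 0"
      using k by (simp add: taylor_coeff_eq_coeff coeff_monom_mult)
  qed
qed

section \<open>Linear functionals on the Fock space\<close>

lemma gen_mult_word: "gen h k * Poly_Mapping.single (Word xs) 1
  = Poly_Mapping.single (Word ((h, k) # xs)) 1"
  by (simp add: gen_def mult_single plus_word_def)

lemma word_Nil_eq_1: "Poly_Mapping.single (Word []) (1::complex) = 1"
  by (simp flip: zero_word_def)

context superspace
begin

abbreviation parity_part :: "bit \<Rightarrow> 'v \<Rightarrow> 'v" where
  "parity_part \<alpha> x \<equiv> component UNIV par x \<alpha>"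

text \<open>The dual space of \<open>\<F>(\<hh>)\<close>, realised on the free algebra so that the
  quotient itself needs no linear structure.\<close>

definition fock_functional :: "('v free \<Rightarrow> complex) \<Rightarrow> bool" where
  "fock_functional \<phi> \<longleftrightarrow> (\<forall>p q. \<phi> (p + q) = \<phi> p + \<phi> q) \<and> (\<forall>c p. \<phi> (fscale c p) = c * \<phi> p) \<and>
     (\<forall>p \<in> fock_ideal scale par. \<phi> p = 0)"

lemma fock_functionalD:
  assumes "fock_functional \<phi>"
  shows "\<phi> (p + q) = \<phi> p + \<phi> q" "\<phi> (fscale c p) = c * \<phi> p" "p \<in> fock_ideal scale par \<Longrightarrow> \<phi> p = 0"
    "\<phi> (p - q) = \<phi> p - \<phi> q"
proof -
  show *: "\<phi> (p + q) = \<phi> p + \<phi> q" "\<phi> (fscale c p) = c * \<phi> p" "p \<in> fock_ideal scale par \<Longrightarrow> \<phi> p = 0"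
    for p q
    using assms by (auto simp: fock_functional_def)
  show "\<phi> (p - q) = \<phi> p - \<phi> q"
    using *(1)[of "p - q" q] by simp
qed

lemma fock_ideal_mult_left:
  assumes "p \<in> fock_ideal scale par"
  shows "x * p \<in> fock_ideal scale par"
  using assms unfolding fock_ideal_def
proof induction
  case zero
  show ?case by (simp add: two_sided_ideal.zero)
next
  case (base r a b)
  then have "(x * a) * r * b \<in> two_sided_ideal (fock_relations scale par)"
    by (rule two_sided_ideal.base)
  then show ?case by (simp add: mult.assoc)
next
  case (sum p q)
  then show ?case by (simp add: distrib_left two_sided_ideal.sum)
qed

lemma fock_functional_mult_left:
  "fock_functional \<phi> \<Longrightarrow> fock_functional (\<lambda>p. \<phi> (x * p))"
  by (auto simp: fock_functional_def distrib_left fscale_mult_right fock_ideal_mult_left)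

lemma fock_functional_0: "fock_functional (\<lambda>p. 0)"
  by (simp add: fock_functional_def)

lemma fock_functional_add:
  "fock_functional \<phi> \<Longrightarrow> fock_functional \<psi> \<Longrightarrow> fock_functional (\<lambda>p. \<phi> p + \<psi> p)"
  by (auto simp: fock_functional_def algebra_simps)

lemma fock_functional_cmult:
  "fock_functional \<phi> \<Longrightarrow> fock_functional (\<lambda>p. c * \<phi> p)"
  by (auto simp: fock_functional_def algebra_simps)

lemma fock_functional_sum:
  "(\<And>i. i \<in> S \<Longrightarrow> fock_functional (\<phi> i)) \<Longrightarrow> fock_functional (\<lambda>p. \<Sum>i\<in>S. \<phi> i p)"
  by (induction S rule: infinite_finite_induct)
    (simp_all add: fock_functional_0 fock_functional_add)

lemma fock_ideal_relation:
  assumes "r \<in> fock_relations scale par"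
  shows "r * q \<in> fock_ideal scale par"
  using two_sided_ideal.base[OF assms, of 1 q] by (simp add: fock_ideal_def)

text \<open>The relations appear with an arbitrary right factor \<open>q\<close> because
  \<open>letter_act\<close> multiplies its arguments by generators from the left.\<close>

lemma
  assumes \<phi>: "fock_functional \<phi>"
  shows fock_functional_gen_add: "\<phi> (gen (x + y) k * q) = \<phi> (gen x k * q) + \<phi> (gen y k * q)"
    and fock_functional_gen_scale: "\<phi> (gen (scale c x) k * q) = c * \<phi> (gen x k * q)"
    and fock_functional_gen_commute: "x \<in> par \<alpha> \<Longrightarrow> y \<in> par \<beta> \<Longrightarrow>
      \<phi> (gen x k * (gen y l * q)) = koszul \<alpha> \<beta> * \<phi> (gen y l * (gen x k * q))"
proof -
  have "(gen (x + y) k - gen x k - gen y k) * q \<in> fock_ideal scale par"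
    by (rule fock_ideal_relation) (unfold fock_relations_def, blast)
  from fock_functionalD(3)[OF \<phi> this]
  show "\<phi> (gen (x + y) k * q) = \<phi> (gen x k * q) + \<phi> (gen y k * q)"
    by (simp add: left_diff_distrib fock_functionalD(4)[OF \<phi>] diff_eq_eq add.commute)
  have "(gen (scale c x) k - fscale c (gen x k)) * q \<in> fock_ideal scale par"
    by (rule fock_ideal_relation) (unfold fock_relations_def, blast)
  from fock_functionalD(3)[OF \<phi> this]
  show "\<phi> (gen (scale c x) k * q) = c * \<phi> (gen x k * q)"
    by (simp add: left_diff_distrib fock_functionalD(2,4)[OF \<phi>] fscale_mult_left)
  assume "x \<in> par \<alpha>" "y \<in> par \<beta>"
  then have "(gen x k * gen y l - fscale (koszul \<alpha> \<beta>) (gen y l * gen x k)) * q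
    \<in> fock_ideal scale par"
    by (intro fock_ideal_relation) (unfold fock_relations_def, blast)
  from fock_functionalD(3)[OF \<phi> this]
  show "\<phi> (gen x k * (gen y l * q)) = koszul \<alpha> \<beta> * \<phi> (gen y l * (gen x k * q))"
    by (simp add: left_diff_distrib fock_functionalD(2,4)[OF \<phi>] fscale_mult_left mult.assoc)
qed

lemma fock_functional_gen_0: "fock_functional \<phi> \<Longrightarrow> \<phi> (gen 0 k * q) = 0"
  using fock_functional_gen_scale[of \<phi> 0 0 k q] by simp

lemma fock_functional_gen_parts:
  "fock_functional \<phi> \<Longrightarrow> (\<Sum>\<alpha>\<in>{0,1}. \<phi> (gen (parity_part \<alpha> x) k * q)) = \<phi> (gen x k * q)"
  using fock_functional_gen_add[of \<phi> "parity_part 0 x" "parity_part 1 x" k q]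
  by (simp add: parity_decomposition)

end

section \<open>Substitution of letters, transposed to functionals on the tensor square\<close>

type_synonym 'h kernel = "bit \<Rightarrow> 'h free \<Rightarrow> 'h free \<Rightarrow> complex"

text \<open>Keeps sums of parities as sums.\<close>

declare add_bit_eq_xor [simp del]

text \<open>A kernel encodes a functional on \<open>\<F>(\<hh>) \<otimes> \<F>(\<hh>)\<close>, and \<open>letter_act\<close> is the transpose of
  left multiplication by
  \<open>(\<Sum>m<N. e\<^sub>m\<^sub>k h(-m-1) \<otimes> 1 + f\<^sub>m\<^sub>k 1 \<otimes> h(-m-1))\<close>, the image of the letter \<open>(h, k)\<close>. Odd elements
  of the two factors anticommute; the bit argument records the parity by which the first factor has
  been multiplied so far, and so produces this sign without a parity operator on \<open>\<F>(\<hh>)\<close>.\<close>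

context superspace
begin

definition letter_act ::
  "(nat \<Rightarrow> nat \<Rightarrow> complex) \<Rightarrow> (nat \<Rightarrow> nat \<Rightarrow> complex) \<Rightarrow> nat \<Rightarrow> 'v \<times> nat \<Rightarrow> 'v kernel \<Rightarrow> 'v kernel" where
  "letter_act e f N x \<gamma> = (\<lambda>\<epsilon> p q. \<Sum>\<alpha>\<in>{0,1}. \<Sum>m<N.
      e m (snd x) * \<gamma> (\<epsilon> + \<alpha>) (gen (parity_part \<alpha> (fst x)) m * p) q
    + f m (snd x) * (koszul \<epsilon> \<alpha> * \<gamma> \<epsilon> p (gen (parity_part \<alpha> (fst x)) m * q)))"

abbreviation word_act ::
  "(nat \<Rightarrow> nat \<Rightarrow> complex) \<Rightarrow> (nat \<Rightarrow> nat \<Rightarrow> complex) \<Rightarrow> nat \<Rightarrow> ('v \<times> nat) list \<Rightarrow> 'v kernel \<Rightarrow> 'v kernel"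
    where
  "word_act e f N \<equiv> fold (letter_act e f N)"

definition fock_kernel :: "'v kernel \<Rightarrow> bool" where
  "fock_kernel \<gamma> \<longleftrightarrow> (\<forall>\<epsilon> q. fock_functional (\<lambda>p. \<gamma> \<epsilon> p q)) \<and> (\<forall>\<epsilon> p. fock_functional (\<gamma> \<epsilon> p))"

lemma fock_kernelD:
  "fock_kernel \<gamma> \<Longrightarrow> fock_functional (\<lambda>p. \<gamma> \<epsilon> p q)"
  "fock_kernel \<gamma> \<Longrightarrow> fock_functional (\<lambda>q. \<gamma> \<epsilon> p q)"
  by (simp_all add: fock_kernel_def)

lemma fock_kernel_letter_act:
  assumes "fock_kernel \<gamma>"
  shows "fock_kernel (letter_act e f N x \<gamma>)"
proof -
  have "fock_functional (\<lambda>p. \<gamma> \<epsilon> (a * p) q)" "fock_functional (\<lambda>q. \<gamma> \<epsilon> p (a * q))" for a p q \<epsilon>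
    by (intro fock_functional_mult_left fock_kernelD assms)+
  then show ?thesis
    unfolding fock_kernel_def letter_act_def
    by (intro conjI allI fock_functional_sum fock_functional_add fock_functional_cmult)
      (simp_all add: fock_kernelD[OF assms])
qed

lemma fock_kernel_word_act: "fock_kernel \<gamma> \<Longrightarrow> fock_kernel (word_act e f N xs \<gamma>)"
  by (induction xs arbitrary: \<gamma>) (simp_all add: fock_kernel_letter_act)

lemma letter_act_add:
  "letter_act e f N x (\<lambda>\<epsilon> p q. \<gamma> \<epsilon> p q + \<delta> \<epsilon> p q)
    = (\<lambda>\<epsilon> p q. letter_act e f N x \<gamma> \<epsilon> p q + letter_act e f N x \<delta> \<epsilon> p q)"
  by (simp add: letter_act_def fun_eq_iff sum.distrib algebra_simps)

lemma letter_act_cmult: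
  "letter_act e f N x (\<lambda>\<epsilon> p q. c * \<gamma> \<epsilon> p q) = (\<lambda>\<epsilon> p q. c * letter_act e f N x \<gamma> \<epsilon> p q)"
  by (simp add: letter_act_def fun_eq_iff sum.distrib sum_distrib_left algebra_simps)

lemma word_act_add:
  "word_act e f N xs (\<lambda>\<epsilon> p q. \<gamma> \<epsilon> p q + \<delta> \<epsilon> p q)
    = (\<lambda>\<epsilon> p q. word_act e f N xs \<gamma> \<epsilon> p q + word_act e f N xs \<delta> \<epsilon> p q)"
  by (induction xs arbitrary: \<gamma> \<delta>) (simp_all add: letter_act_add)

lemma word_act_cmult:
  "word_act e f N xs (\<lambda>\<epsilon> p q. c * \<gamma> \<epsilon> p q) = (\<lambda>\<epsilon> p q. c * word_act e f N xs \<gamma> \<epsilon> p q)"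
  by (induction xs arbitrary: \<gamma>) (simp_all add: letter_act_cmult)

lemma word_act_0: "word_act e f N xs (\<lambda>\<epsilon> p q. 0) = (\<lambda>\<epsilon> p q. 0)"
  using word_act_cmult[of e f N xs 0 "\<lambda>\<epsilon> p q. 0"] by simp

lemma word_act_sum:
  "finite S \<Longrightarrow> word_act e f N xs (\<lambda>\<epsilon> p q. \<Sum>i\<in>S. \<gamma> i \<epsilon> p q)
    = (\<lambda>\<epsilon> p q. \<Sum>i\<in>S. word_act e f N xs (\<gamma> i) \<epsilon> p q)"
  by (induction S rule: finite_induct) (simp_all add: word_act_0 word_act_add)

lemma word_act_lin:
  "word_act e f N xs (\<lambda>\<epsilon> p q. lin (\<lambda>w. \<gamma> w \<epsilon> p q) r)
    = (\<lambda>\<epsilon> p q. lin (\<lambda>w. word_act e f N xs (\<gamma> w) \<epsilon> p q) r)"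
  unfolding lin_def by (simp add: word_act_sum word_act_cmult)

lemma parity_part_add: "parity_part \<alpha> (x + y) = parity_part \<alpha> x + parity_part \<alpha> y"
  by (rule component_add[OF par_sum]) auto

lemma parity_part_scale: "parity_part \<alpha> (scale c x) = scale c (parity_part \<alpha> x)"
  by (rule component_scale[OF par_sum]) auto

lemma parity_part_homogeneous: "x \<in> par \<beta> \<Longrightarrow> parity_part \<alpha> x = (if \<alpha> = \<beta> then x else 0)"
  by (simp add: component_of_summand[OF par_sum])

lemma letter_act_letter_add:
  assumes "fock_kernel \<gamma>"
  shows "letter_act e f N (x + y, k) \<gamma>
    = (\<lambda>\<epsilon> p q. letter_act e f N (x, k) \<gamma> \<epsilon> p q + letter_act e f N (y, k) \<gamma> \<epsilon> p q)"
  by (simp add: letter_act_def fun_eq_iff parity_part_add sum.distrib algebra_simps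
      fock_functional_gen_add[OF fock_kernelD(1)[OF assms]]
      fock_functional_gen_add[OF fock_kernelD(2)[OF assms]])

lemma letter_act_letter_scale:
  assumes "fock_kernel \<gamma>"
  shows "letter_act e f N (scale c x, k) \<gamma> = (\<lambda>\<epsilon> p q. c * letter_act e f N (x, k) \<gamma> \<epsilon> p q)"
  by (simp add: letter_act_def fun_eq_iff parity_part_scale sum.distrib sum_distrib_left
    algebra_simps
      fock_functional_gen_scale[OF fock_kernelD(1)[OF assms]]
      fock_functional_gen_scale[OF fock_kernelD(2)[OF assms]])

text \<open>The other parity component of \<open>x\<close> is 0, so a single parity survives; in
  this form signs can be compared.\<close>

lemma letter_act_homogeneous:
  assumes "fock_kernel \<gamma>" "x \<in> par \<alpha>"
  shows "letter_act e f N (x, k) \<gamma> \<epsilon> p q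
    = (\<Sum>m<N. e m k * \<gamma> (\<epsilon> + \<alpha>) (gen x m * p) q + f m k * (koszul \<epsilon> \<alpha> * \<gamma> \<epsilon> p (gen x m * q)))"
  using assms(2)
  by (cases \<alpha>) (simp_all add: letter_act_def parity_part_homogeneous[OF assms(2)]
      fock_functional_gen_0[OF fock_kernelD(1)[OF assms(1)]]
      fock_functional_gen_0[OF fock_kernelD(2)[OF assms(1)]])

lemma koszul_commute: "koszul \<alpha> \<beta> = koszul \<beta> \<alpha>"
  by (auto simp: koszul_def)

lemma koszul_add: "koszul (\<alpha> + \<beta>) \<delta> = koszul \<alpha> \<delta> * koszul \<beta> \<delta>"
  by (cases \<alpha>; cases \<beta>; cases \<delta>) (simp_all add: koszul_def)

lemma koszul_self: "koszul \<alpha> \<beta> * koszul \<alpha> \<beta> = 1"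
  by (auto simp: koszul_def)

text \<open>The sign has two sources. When both letters enter the same factor (\<open>A\<close> and
  \<open>D\<close>), it comes from supercommutativity in that factor. When they enter different
  factors (\<open>B\<close> and \<open>C\<close>), it comes from the shift of the sign bit.\<close>

lemma letter_act_commute:
  assumes \<gamma>: "fock_kernel \<gamma>" and xy: "x \<in> par \<alpha>" "y \<in> par \<beta>"
  shows "letter_act e f N (y, l) (letter_act e f N (x, k) \<gamma>)
    = (\<lambda>\<epsilon> p q. koszul \<alpha> \<beta> * letter_act e f N (x, k) (letter_act e f N (y, l) \<gamma>) \<epsilon> p q)"
proof (intro ext)
  fix \<epsilon> p q
  note \<gamma>' = fock_kernel_letter_act[OF \<gamma>]
  define A where "A n m = \<gamma> (\<epsilon> + \<alpha> + \<beta>) (gen x n * (gen y m * p)) q" for n m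
  define B where "B n m = \<gamma> (\<epsilon> + \<beta>) (gen y m * p) (gen x n * q)" for n m
  define C where "C n m = \<gamma> (\<epsilon> + \<alpha>) (gen x n * p) (gen y m * q)" for n m
  define D where "D n m = \<gamma> \<epsilon> p (gen x n * (gen y m * q))" for n m
  have "letter_act e f N (y, l) (letter_act e f N (x, k) \<gamma>) \<epsilon> p q
    = (\<Sum>m<N. \<Sum>n<N. e m l * (e n k * A n m) + e m l * (f n k * (koszul (\<epsilon> + \<beta>) \<alpha> * B n m))
        + f m l * (koszul \<epsilon> \<beta> * (e n k * C n m)) + f m l * (koszul \<epsilon> \<beta> * (f n k * (koszul \<epsilon> \<alpha> * D
          n m))))"
    by (simp add: letter_act_homogeneous[OF \<gamma>' xy(2)] letter_act_homogeneous[OF \<gamma> xy(1)]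
        A_def B_def C_def D_def sum.distrib sum_distrib_left distrib_left
        add.assoc add.commute add.left_commute)
  also have "\<dots> = (\<Sum>m<N. \<Sum>n<N. koszul \<alpha> \<beta> * (e n k * (e m l * (koszul \<alpha> \<beta> * A n m))
        + e n k * (f m l * (koszul (\<epsilon> + \<alpha>) \<beta> * C n m))
        + f n k * (koszul \<epsilon> \<alpha> * (e m l * B n m)) + f n k * (koszul \<epsilon> \<alpha> * (f m l * (koszul \<epsilon> \<beta> *
          (koszul \<alpha> \<beta> * D n m))))))"
  proof (intro sum.cong refl)
    fix m n
    have k: "koszul (\<epsilon> + \<beta>) \<alpha> = koszul \<epsilon> \<alpha> * koszul \<alpha> \<beta>" "koszul (\<epsilon> + \<alpha>) \<beta>
      = koszul \<epsilon> \<beta> * koszul \<alpha> \<beta>"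
      using koszul_commute[of \<alpha> \<beta>] by (simp_all add: koszul_add)
    have s: "koszul \<alpha> \<beta> * (koszul \<alpha> \<beta> * z) = z" for z
      using koszul_self[of \<alpha> \<beta>] by (simp flip: mult.assoc)
    show "e m l * (e n k * A n m) + e m l * (f n k * (koszul (\<epsilon> + \<beta>) \<alpha> * B n m))
        + f m l * (koszul \<epsilon> \<beta> * (e n k * C n m)) + f m l * (koszul \<epsilon> \<beta> * (f n k * (koszul \<epsilon> \<alpha> * D
          n m)))
      = koszul \<alpha> \<beta> * (e n k * (e m l * (koszul \<alpha> \<beta> * A n m))
        + e n k * (f m l * (koszul (\<epsilon> + \<alpha>) \<beta> * C n m))
        + f n k * (koszul \<epsilon> \<alpha> * (e m l * B n m)) + f n k * (koszul \<epsilon> \<alpha> * (f m l * (koszul \<epsilon> \<beta> *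
          (koszul \<alpha> \<beta> * D n m)))))"
      unfolding k by (simp add: distrib_left mult.assoc mult.left_commute s)
  qed
  also have "\<dots> = (\<Sum>n<N. \<Sum>m<N. koszul \<alpha> \<beta> * (e n k * (e m l * (koszul \<alpha> \<beta> * A n m))
        + e n k * (f m l * (koszul (\<epsilon> + \<alpha>) \<beta> * C n m))
        + f n k * (koszul \<epsilon> \<alpha> * (e m l * B n m)) + f n k * (koszul \<epsilon> \<alpha> * (f m l * (koszul \<epsilon> \<beta> *
          (koszul \<alpha> \<beta> * D n m))))))"
    by (rule sum.swap)
  also have "\<dots> = koszul \<alpha> \<beta> * letter_act e f N (x, k) (letter_act e f N (y, l) \<gamma>) \<epsilon> p q"
  proof -
    have "\<gamma> (\<epsilon> + \<alpha> + \<beta>) (gen y m * (gen x n * p)) q = koszul \<alpha> \<beta> * A n m"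
      "\<gamma> \<epsilon> p (gen y m * (gen x n * q)) = koszul \<alpha> \<beta> * D n m" for m n
      using fock_functional_gen_commute[OF fock_kernelD(1)[OF \<gamma>] xy(2,1)]
        fock_functional_gen_commute[OF fock_kernelD(2)[OF \<gamma>] xy(2,1)]
      by (simp_all add: A_def D_def koszul_commute)
    then show ?thesis
      by (simp add: letter_act_homogeneous[OF \<gamma>' xy(1)] letter_act_homogeneous[OF \<gamma> xy(2)]
        B_def C_def sum.distrib sum_distrib_left distrib_left
        add.assoc add.commute add.left_commute)
  qed
  finally show "letter_act e f N (y, l) (letter_act e f N (x, k) \<gamma>) \<epsilon> p q
    = koszul \<alpha> \<beta> * letter_act e f N (x, k) (letter_act e f N (y, l) \<gamma>) \<epsilon> p q" .
qed

text \<open>The substitution descends from the free algebra to \<open>\<F>(\<hh>)\<close>. Letters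
  to the left of a relation merely replace \<open>\<gamma>\<close> by another kernel, and letters to
  its right act linearly, so only the three defining relations have to be checked.\<close>

lemma lin_word_act_ideal:
  assumes \<gamma>: "fock_kernel \<gamma>" and r: "r \<in> fock_ideal scale par"
  shows "lin (\<lambda>w. word_act e f N (letters w) \<gamma> \<epsilon> p q) r = 0" (is "lin ?g r = 0")
  using r unfolding fock_ideal_def
proof induction
  case (base r a b)
  have word: "lin ?g (Poly_Mapping.single (Word xs) 1 * r * Poly_Mapping.single (Word ys) 1) = 0"
    for xs ys
  proof -
    define \<delta> where "\<delta> = word_act e f N xs \<gamma>"
    have \<delta>: "fock_kernel \<delta>"
      unfolding \<delta>_def by (rule fock_kernel_word_act[OF \<gamma>])
    have g: "lin ?g (Poly_Mapping.single (Word xs) 1 * s * Poly_Mapping.single (Word ys) 1)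
      = lin (\<lambda>w. word_act e f N ys (word_act e f N (letters w) \<delta>) \<epsilon> p q) s" for s
      by (simp add: lin_mult plus_word_def \<delta>_def)
    from base consider
      (1) x y k where "r = gen (x + y) k - gen x k - gen y k"
      | (2) c x k where "r = gen (scale c x) k - fscale c (gen x k)"
      | (3) x k y l \<alpha> \<beta> where "r = gen x k * gen y l - fscale (koszul \<alpha> \<beta>) (gen y l * gen x k)"
          "x \<in> par \<alpha>" "y \<in> par \<beta>"
      unfolding fock_relations_def by blast
    then show ?thesis
    proof cases
      case 1
      show ?thesis
        unfolding g 1 by (simp add: gen_def lin_diff letter_act_letter_add[OF \<delta>] word_act_add)
    next
      case 2
      show ?thesis
        unfolding g 2 by (simp add: gen_def lin_diff letter_act_letter_scale[OF \<delta>] word_act_cmult)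
    next
      case 3
      show ?thesis
        unfolding g 3(1)
        by (simp add: gen_def lin_diff mult_single plus_word_def letter_act_commute[OF \<delta> 3(2,3)]
          word_act_cmult)
    qed
  qed
  have "lin ?g (Poly_Mapping.single (Word xs) 1 * r * b) = 0" for xs
  proof (induction b rule: poly_mapping_additive_induct)
    case (single w d)
    have "Poly_Mapping.single w d = fscale d (Poly_Mapping.single (Word (letters w)) 1)"
      by simp
    then show ?case
      by (simp only: fscale_mult_right lin_fscale word) simp
  qed (simp add: distrib_left lin_add)
  note right = this
  show ?case
  proof (induction a rule: poly_mapping_additive_induct)
    case (single w d)
    have "Poly_Mapping.single w d = fscale d (Poly_Mapping.single (Word (letters w)) 1)"
      by simp
    then show ?case
      by (simp only: fscale_mult_left lin_fscale right) simp
  qed (simp add: distrib_right lin_add)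
qed (simp_all add: lin_add)

end

section \<open>Translation as a flow, and injectivity on the Fock space\<close>

context superspace
begin

abbreviation taylor_act ::
  "(nat \<Rightarrow> complex poly) \<Rightarrow> (nat \<Rightarrow> complex poly) \<Rightarrow> nat \<Rightarrow> complex \<Rightarrow> 'v \<times> nat \<Rightarrow> 'v kernel \<Rightarrow> 'v kernel"
    where
  "taylor_act E F N s \<equiv>
     letter_act (\<lambda>m k. taylor_coeff (E m) k s) (\<lambda>m k. taylor_coeff (F m) k s) N"

text \<open>Differentiating the k-th Taylor coefficient gives k + 1 times the next one, which is the
  rule for \<partial> on a letter.\<close>

lemma has_field_derivative_taylor_act:
  assumes "\<And>\<epsilon> p q. ((\<lambda>s. \<gamma> s \<epsilon> p q) has_field_derivative \<gamma>' \<epsilon> p q) (at s)"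
  shows "((\<lambda>s. taylor_act E F N s (h, k) (\<gamma> s) \<epsilon> p q) has_field_derivative
    taylor_act E F N s (h, k) \<gamma>' \<epsilon> p q + of_nat (Suc k) * taylor_act E F N s (h, Suc k) (\<gamma> s) \<epsilon> p
      q) (at s)"
proof -
  let ?g = "\<lambda>\<alpha> m. gen (parity_part \<alpha> h) m"
  have "((\<lambda>s. taylor_coeff (E m) k s * \<gamma> s (\<epsilon> + \<alpha>) (?g \<alpha> m * p) q
      + taylor_coeff (F m) k s * (koszul \<epsilon> \<alpha> * \<gamma> s \<epsilon> p (?g \<alpha> m * q))) has_field_derivative
      (taylor_coeff (E m) k s * \<gamma>' (\<epsilon> + \<alpha>) (?g \<alpha> m * p) q
      + taylor_coeff (F m) k s * (koszul \<epsilon> \<alpha> * \<gamma>' \<epsilon> p (?g \<alpha> m * q)))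
      + of_nat (Suc k) * (taylor_coeff (E m) (Suc k) s * \<gamma> s (\<epsilon> + \<alpha>) (?g \<alpha> m * p) q
      + taylor_coeff (F m) (Suc k) s * (koszul \<epsilon> \<alpha> * \<gamma> s \<epsilon> p (?g \<alpha> m * q)))) (at s)" for \<alpha> m
    by (rule derivative_eq_intros has_field_derivative_taylor_coeff assms refl)+
      (simp add: algebra_simps)
  then have "((\<lambda>s. taylor_act E F N s (h, k) (\<gamma> s) \<epsilon> p q) has_field_derivative
      (\<Sum>\<alpha>\<in>{0,1}. \<Sum>m<N. (taylor_coeff (E m) k s * \<gamma>' (\<epsilon> + \<alpha>) (?g \<alpha> m * p) q
      + taylor_coeff (F m) k s * (koszul \<epsilon> \<alpha> * \<gamma>' \<epsilon> p (?g \<alpha> m * q)))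
      + of_nat (Suc k) * (taylor_coeff (E m) (Suc k) s * \<gamma> s (\<epsilon> + \<alpha>) (?g \<alpha> m * p) q
      + taylor_coeff (F m) (Suc k) s * (koszul \<epsilon> \<alpha> * \<gamma> s \<epsilon> p (?g \<alpha> m * q))))) (at s)"
    unfolding letter_act_def fst_conv snd_conv by (intro DERIV_sum)
  then show ?thesis
    by (rule DERIV_cong) (simp only: letter_act_def fst_conv snd_conv sum.distrib[symmetric]
      sum_distrib_left)
qed

lemma lin_deriv_word_Cons:
  "lin g (deriv_word ((h, k) # xs)) = of_nat (Suc k) * g (Word ((h, Suc k) # xs))
    + lin (\<lambda>w. g (Word ((h, k) # letters w))) (deriv_word xs)"
  by (simp add: lin_add fscale_mult_left lin_fscale gen_mult_word)
    (simp add: gen_def lin_mult plus_word_def)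

text \<open>Product rule: the derivative falls either on the starting functional or on one letter,
  and the latter terms add up to \<open>deriv_word\<close>. The functional must depend on
  \<open>s\<close> for the induction, since \<open>fold\<close> absorbs the letters already
  processed into it.\<close>

lemma has_field_derivative_taylor_word_act:
  assumes "\<And>\<epsilon> p q. ((\<lambda>s. \<gamma> s \<epsilon> p q) has_field_derivative \<gamma>' \<epsilon> p q) (at s)"
  shows "((\<lambda>s. fold (taylor_act E F N s) xs (\<gamma> s) \<epsilon> p q) has_field_derivative
    fold (taylor_act E F N s) xs \<gamma>' \<epsilon> p q
    + lin (\<lambda>w. fold (taylor_act E F N s) (letters w) (\<gamma> s) \<epsilon> p q) (deriv_word xs)) (at s)"
  using assms
proof (induction xs arbitrary: \<gamma> \<gamma>' \<epsilon> p q)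
  case Nil
  then show ?case by simp
next
  case (Cons x xs)
  obtain h k where x: "x = (h, k)"
    by fastforce
  from Cons.IH[OF has_field_derivative_taylor_act[OF Cons.prems, of E F N h k]]
  show ?case
    by (simp only: x fold_simps lin_deriv_word_Cons word_act_add word_act_cmult word.sel add.assoc)
qed

text \<open>Counterpart for the second factor, whose letters are substituted at the fixed base point
  0.\<close>

lemma has_field_derivative_word_act:
  assumes "\<And>\<epsilon> p q. ((\<lambda>s. \<gamma> s \<epsilon> p q) has_field_derivative \<gamma>' \<epsilon> p q) (at s)"
  shows "((\<lambda>s. word_act e f N xs (\<gamma> s) \<epsilon> p q) has_field_derivative word_act e f N xs \<gamma>' \<epsilon> p q) (at
    s)"
  using assms
proof (induction xs arbitrary: \<gamma> \<gamma>' \<epsilon> p q)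
  case (Cons x xs)
  have "((\<lambda>s. letter_act e f N x (\<gamma> s) \<epsilon> p q) has_field_derivative letter_act e f N x \<gamma>' \<epsilon> p q)
    (at s)" for \<epsilon> p q
    unfolding letter_act_def by (intro DERIV_sum DERIV_add DERIV_cmult Cons.prems)
  then show ?case
    unfolding fold_simps by (rule Cons.IH)
qed simp

text \<open>The jets select the mode \<open>k\<close> of the first factor and suppress the second
  factor. The shift of the sign bit is invisible because \<open>\<beta>\<close> does not depend on
  it.\<close>

lemma word_act_left:
  assumes "fock_kernel (\<lambda>\<epsilon>. \<beta>)"
    and "\<And>m k. k < N \<Longrightarrow> e m k = (if k = m then 1 else 0)" "\<And>m k. k < N \<Longrightarrow> f m k = 0"
    and "\<forall>x\<in>set xs. snd x < N"
  shows "word_act e f N xs (\<lambda>\<epsilon>. \<beta>) = (\<lambda>\<epsilon> p q. \<beta> (Poly_Mapping.single (Word xs) 1 * p) q)"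
  using assms(1,4)
proof (induction xs arbitrary: \<beta>)
  case Nil
  then show ?case by (simp add: word_Nil_eq_1)
next
  case (Cons x xs)
  obtain h k where x: "x = (h, k)"
    by fastforce
  with Cons.prems have k: "k < N"
    by simp
  have *: "letter_act e f N x (\<lambda>\<epsilon>. \<beta>) = (\<lambda>\<epsilon> p q. \<beta> (gen h k * p) q)"
  proof (intro ext)
    fix \<epsilon> p q
    have "letter_act e f N x (\<lambda>\<epsilon>. \<beta>) \<epsilon> p q = (\<Sum>\<alpha>\<in>{0,1}. \<Sum>m<N. if k
      = m then \<beta> (gen (parity_part \<alpha> h) m * p) q else 0)"
      unfolding letter_act_def by (intro sum.cong) (simp_all add: x assms(2,3) k)
    also have "\<dots> = (\<Sum>\<alpha>\<in>{0,1}. \<beta> (gen (parity_part \<alpha> h) k * p) q)"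
      using k by simp
    also have "\<dots> = \<beta> (gen h k * p) q"
      by (rule fock_functional_gen_parts) (rule fock_kernelD(1)[OF Cons.prems(1)])
    finally show "letter_act e f N x (\<lambda>\<epsilon>. \<beta>) \<epsilon> p q = \<beta> (gen h k * p) q" .
  qed
  have "fock_kernel (\<lambda>\<epsilon> p q. \<beta> (gen h k * p) q)"
    using fock_kernel_letter_act[OF Cons.prems(1), of e f N x] unfolding * .
  from Cons.IH[OF this] Cons.prems(2) show ?case
    by (simp add: *[unfolded x] x gen_mult_word[symmetric] mult.assoc)
qed

text \<open>Nothing enters the first factor, so the sign bit remains 0 and all Koszul signs are
  1.\<close>

lemma word_act_right:
  assumes "fock_kernel \<gamma>"
    and "\<And>m k. k < N \<Longrightarrow> f m k = (if k = m then 1 else 0)" "\<And>m k. k < N \<Longrightarrow> e m k = 0"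
    and "\<forall>x\<in>set xs. snd x < N"
  shows "word_act e f N xs \<gamma> 0 p q = \<gamma> 0 p (Poly_Mapping.single (Word xs) 1 * q)"
  using assms(1,4)
proof (induction xs arbitrary: \<gamma>)
  case Nil
  then show ?case by (simp add: word_Nil_eq_1)
next
  case (Cons x xs)
  obtain h k where x: "x = (h, k)"
    by fastforce
  with Cons.prems have k: "k < N"
    by simp
  have *: "letter_act e f N x \<gamma> 0 p q = \<gamma> 0 p (gen h k * q)" for q
  proof -
    have "letter_act e f N x \<gamma> 0 p q = (\<Sum>\<alpha>\<in>{0,1}. \<Sum>m<N. if k
      = m then \<gamma> 0 p (gen (parity_part \<alpha> h) m * q) else 0)"
      unfolding letter_act_def by (intro sum.cong) (simp_all add: x assms(2,3) k koszul_def)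
    also have "\<dots> = (\<Sum>\<alpha>\<in>{0,1}. \<gamma> 0 p (gen (parity_part \<alpha> h) k * q))"
      using k by simp
    also have "\<dots> = \<gamma> 0 p (gen h k * q)"
      by (rule fock_functional_gen_parts) (rule fock_kernelD(2)[OF Cons.prems(1)])
    finally show ?thesis .
  qed
  from Cons.IH[OF fock_kernel_letter_act[OF Cons.prems(1)]] Cons.prems(2) show ?case
    by (simp add: *[unfolded x] x gen_mult_word[symmetric] mult.assoc)
qed

lemma lin_free_deriv: "lin g (free_deriv p) = lin (\<lambda>w. lin g (deriv_word (letters w))) p"
  by (simp add: free_deriv_def lin_sum lin_fscale) (simp add: lin_def)

text \<open>Says that \<Sum> a_i \<otimes> b_i = 0, tested on product functionals. Let \<Phi>_s be
  the substitution with Taylor coefficients taken at s. Then \<Phi>_s(a) \<Phi>_0(b) =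
  \<Phi>_0(exp(s\<partial>)(a) b), which sums to 0 by hypothesis, while at s = 1 it is a \<otimes>
  b.\<close>

theorem fock_Y_injective:
  fixes a b :: "'i \<Rightarrow> 'v free"
  assumes \<phi>: "fock_functional \<phi>" and \<psi>: "fock_functional \<psi>" and S: "finite S"
    and ideal: "\<And>k. (\<Sum>i\<in>S. (free_deriv ^^ k) (a i) * b i) \<in> fock_ideal scale par"
  shows "(\<Sum>i\<in>S. \<phi> (a i) * \<psi> (b i)) = 0"
proof -
  define W where "W i = Poly_Mapping.keys (a i) \<union> Poly_Mapping.keys (b i)" for i
  \<comment> \<open>The prescribed jets are read off only in \<open>H_1\<close>, for the
    \<open>a i\<close> and \<open>b i\<close> themselves. Iterates of \<open>free_deriv\<close> may
    reach modes beyond \<open>N\<close>, but there only the general form of the substitution is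
    used.\<close>
  have "finite (\<Union>i\<in>S. \<Union>w\<in>W i. snd ` set (letters w))"
    using S by (auto simp: W_def)
  then obtain N where "\<forall>n\<in>(\<Union>i\<in>S. \<Union>w\<in>W i. snd ` set (letters w)). n < N"
    unfolding finite_nat_set_iff_bounded ..
  then have N: "snd x < N" if "i \<in> S" "w \<in> W i" "x \<in> set (letters w)" for i w x
    using that by blast
  obtain E where E: "\<And>m k. k < N \<Longrightarrow> taylor_coeff (E m) k 1 = (if k = m then 1 else 0)"
      "\<And>m k. k < N \<Longrightarrow> taylor_coeff (E m) k 0 = 0"
    using hermite_interpolation[of 1 0 N] by auto
  obtain F where F: "\<And>m k. k < N \<Longrightarrow> taylor_coeff (F m) k 0 = (if k = m then 1 else 0)"
      "\<And>m k. k < N \<Longrightarrow> taylor_coeff (F m) k 1 = 0"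
    using hermite_interpolation[of 0 1 N] by auto
  define \<beta> where "\<beta> = (\<lambda>p q. \<phi> p * \<psi> q)"
  have \<beta>: "fock_kernel (\<lambda>\<epsilon>. \<beta>)"
    unfolding fock_kernel_def \<beta>_def
    using fock_functional_cmult[OF \<phi>, of "\<psi> _"] fock_functional_cmult[OF \<psi>]
    by (subst mult.commute) blast
  define act where "act s = fold (taylor_act E F N s)" for s
  \<comment> \<open>Pairs \<open>\<beta>\<close> with \<Phi>_s(p) \<Phi>_0(q) applied to 1 \<otimes>
    1. Transposition reverses the order of the factors and \<open>fold\<close> reverses it back,
    hence the letters of \<open>p\<close> act on the functional before those of
    \<open>q\<close>.\<close>
  define H where "H s p q = lin (\<lambda>w'. lin (\<lambda>w. act 0 (letters w') (act s (letters w) (\<lambda>\<epsilon>. \<beta>)) 0 1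
    1) p) q" for s p q
  have H_0: "H 0 p q = lin (\<lambda>w. act 0 (letters w) (\<lambda>\<epsilon>. \<beta>) 0 1 1) (p * q)" for p q
    by (simp add: H_def lin_mult plus_word_def act_def)
  have H_1: "H 1 (a i) (b i) = \<phi> (a i) * \<psi> (b i)" if i: "i \<in> S" for i
  proof -
    have "H 1 (a i) (b i) = lin (\<lambda>w'. lin (\<lambda>w. \<phi> (Poly_Mapping.single (Word (letters w)) 1)
        * \<psi> (Poly_Mapping.single (Word (letters w')) 1)) (a i)) (b i)"
      unfolding H_def act_def
    proof (intro lin_cong)
      fix w' w assume w: "w' \<in> Poly_Mapping.keys (b i)" "w \<in> Poly_Mapping.keys (a i)"
      then have "\<forall>x\<in>set (letters w'). snd x < N" "\<forall>x\<in>set (letters w). snd x < N"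
        using N[OF i] by (auto simp: W_def)
      then show "fold (taylor_act E F N 0) (letters w') (fold (taylor_act E F N 1) (letters w)
        (\<lambda>\<epsilon>. \<beta>)) 0 1 1
        = \<phi> (Poly_Mapping.single (Word (letters w)) 1) * \<psi> (Poly_Mapping.single (Word (letters
          w')) 1)"
        by (subst word_act_right[OF fock_kernel_word_act[OF \<beta>]])
          (simp_all add: E F word_act_left[OF \<beta>], simp add: \<beta>_def)
    qed
    also have "\<dots> = lin (\<lambda>w'. \<phi> (a i) * \<psi> (Poly_Mapping.single w' 1)) (b i)"
      using lin_linear[of \<phi>, OF fock_functionalD(1,2)[OF \<phi>]]
      by (simp add: mult.commute[of _ "\<psi> _"] lin_fun_cmult)
    also have "\<dots> = \<phi> (a i) * \<psi> (b i)"
      using lin_linear[of \<psi>, OF fock_functionalD(1,2)[OF \<psi>]] by (simp add: lin_fun_cmult)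
    finally show ?thesis .
  qed
  have H_deriv: "((\<lambda>s. H s p q) has_field_derivative H s (free_deriv p) q) (at s)" for s p q
  proof -
    have "((\<lambda>s. act s xs (\<lambda>\<epsilon>. \<beta>) \<epsilon> p q) has_field_derivative
        lin (\<lambda>w. act s (letters w) (\<lambda>\<epsilon>. \<beta>) \<epsilon> p q) (deriv_word xs)) (at s)" for xs \<epsilon> p q
      using has_field_derivative_taylor_word_act[of "\<lambda>s \<epsilon>. \<beta>" "\<lambda>\<epsilon> p q. 0" s E F N xs \<epsilon> p q]
      by (simp add: act_def word_act_0)
    note act_deriv = this
    have "((\<lambda>s. act 0 ys (act s xs (\<lambda>\<epsilon>. \<beta>)) \<epsilon> p q) has_field_derivative
        lin (\<lambda>w. act 0 ys (act s (letters w) (\<lambda>\<epsilon>. \<beta>)) \<epsilon> p q) (deriv_word xs)) (at s)"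
          for xs ys \<epsilon> p q
      using has_field_derivative_word_act[where \<gamma> = "\<lambda>s. act s xs (\<lambda>\<epsilon>. \<beta>)", OF act_deriv,
          of "\<lambda>m k. taylor_coeff (E m) k 0" "\<lambda>m k. taylor_coeff (F m) k 0" N ys \<epsilon> p q]
      by (simp add: act_def word_act_lin)
    then show ?thesis
      unfolding H_def lin_free_deriv by (intro has_field_derivative_lin)
  qed
  define G where "G k s = (\<Sum>i\<in>S. H s ((free_deriv ^^ k) (a i)) (b i))" for k s
  have G_deriv: "(G k has_field_derivative G (Suc k) s) (at s)" for k s
    unfolding G_def using H_deriv by (auto intro!: DERIV_sum)
  have iter: "(deriv ^^ k) (G 0) = G k" for k
    by (induction k) (use G_deriv in \<open>auto simp: DERIV_imp_deriv\<close>)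
  \<comment> \<open>An entire function with all derivatives 0 at the origin vanishes at 1 as
    well.\<close>
  have "G 0 1 = 0"
  proof (rule holomorphic_fun_eq_0_on_connected[where f = "G 0" and w = 1 and S = UNIV and z = 0])
    show "G 0 holomorphic_on UNIV"
      unfolding holomorphic_on_def field_differentiable_def using G_deriv by blast
    have "G k 0 = lin (\<lambda>w. act 0 (letters w) (\<lambda>\<epsilon>. \<beta>) 0 1 1) (\<Sum>i\<in>S. (free_deriv ^^ k) (a i) * b i)"
      for k
      by (simp add: G_def H_0 lin_sum)
    then show "(deriv ^^ k) (G 0) 0 = 0" for k
      by (simp add: iter act_def lin_word_act_ideal[OF \<beta> ideal])
  qed auto
  then show ?thesis
    by (simp add: G_def H_1)
qed

end

section \<open>Membership forms of the Jacobi identity\<close>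

lemma Sum_any_single: "(\<And>x. x \<noteq> a \<Longrightarrow> f x = 0) \<Longrightarrow> Sum_any f = f a"
  using Sum_any.expand_superset[of "{a}" f] by auto

text \<open>Holds for infinite support too, where the sum is 0 by convention.\<close>

lemma (in module) subspace_Sum_any: "subspace S \<Longrightarrow> (\<And>x. f x \<in> S) \<Longrightarrow> Sum_any f \<in> S"
  by (simp add: Sum_any.expand_set subspace_sum)

text \<open>The residue in z keeps only the zeroth power of x - y.\<close>

lemma delta_coeff_residue: "delta_coeff r s (- 1) = (if r = 0 \<and> s = 0 then 1 else 0)"
  by (cases "nat s") (auto simp: delta_coeff_def)

text \<open>The coefficient of x^(-1) y^s is, up to sign, the binomial coefficient of s - 1 over s,
  which is 0 for s > 0.\<close>

lemma delta_coeff_minus_one: "delta_coeff (- 1) s t = (if s = 0 \<and> t = 0 then 1 else 0)"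
proof (cases "s > 0 \<and> t = - s")
  case True
  then have "nat (s - 1) < nat s" "(of_int (- 1 + s) :: complex) = of_nat (nat (s - 1))"
    by (auto simp: of_nat_nat)
  then have "(of_int (- 1 + s) :: complex) gchoose nat s = 0"
    by (metis binomial_eq_0 binomial_gbinomial of_nat_0)
  with True show ?thesis
    by (simp add: delta_coeff_def)
qed (auto simp: delta_coeff_def)

context vertex_superalgebra
begin

lemma mode_add_left: "mode (u + u') n v = mode u n v + mode u' n v"
  and mode_add_right: "mode u n (v + v') = mode u n v + mode u n v'"
  and mode_scale_left: "mode (scale c u) n v = scale c (mode u n v)"
  and mode_scale_right: "mode u n (scale c v) = scale c (mode u n v)"
  using mode_linear_left[of n v] mode_linear_right[of u n]
  by (simp_all add: module_hom_iff_linear[symmetric] module_hom_iff)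

lemma mode_zero_left [simp]: "mode 0 n v = 0" and mode_zero_right [simp]: "mode u n 0 = 0"
  using mode_scale_left[of 0 0 n v] mode_scale_right[of u n 0 0] by simp_all

lemma mode_span:
  assumes S: "subspace S" and ab: "\<And>a b. a \<in> A \<Longrightarrow> b \<in> B \<Longrightarrow> mode a n b \<in> S"
    and x: "x \<in> span A" and y: "y \<in> span B"
  shows "mode x n y \<in> S"
proof -
  have "mode a n y \<in> S" if "a \<in> A" for a
  proof -
    have "subspace {y. mode a n y \<in> S}"
      using S by (auto intro!: subspaceI simp: mode_add_right mode_scale_right subspace_0
          subspace_add subspace_scale)
    with y ab[OF that] show ?thesis
      using span_minimal[of B "{y. mode a n y \<in> S}"] by blast
  qed
  moreover have "subspace {x. mode x n y \<in> S}"
    using S by (auto intro!: subspaceI simp: mode_add_left mode_scale_left subspace_0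
        subspace_add subspace_scale)
  ultimately show ?thesis
    using x span_minimal[of A "{x. mode x n y \<in> S}"] by blast
qed

text \<open>Residue of the Jacobi identity in z_0 (exponent a = -1): the supercommutator is a
  combination of terms (u_i v)_k w with i \<ge> 0. For filtration estimates only membership of these
  terms matters, not their coefficients.\<close>

lemma commutator_mem:
  assumes par: "u \<in> par \<alpha>" "v \<in> par \<beta>" "w \<in> par \<gamma>" and S: "subspace S"
    and mem: "\<And>i k. mode (mode u (int i) v) k w \<in> S"
  shows "mode u m (mode v n w) - scale (koszul \<alpha> \<beta>) (mode v n (mode u m w)) \<in> S"
proof -
  let ?b = "- m - 1" and ?c = "- n - 1"
  have 1: "Sum_any (\<lambda>(b', c'). scale (delta_coeff b' c' (- 1))
      (mode u (- (?b - b') - 1) (mode v (- (?c - c') - 1) w))) = mode u m (mode v n w)"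
    by (subst Sum_any_single[of "(0, 0)"]) (auto simp: delta_coeff_residue split: if_splits)
  have 2: "Sum_any (\<lambda>(b', c'). scale ((-1) powi (- (- 1) - 1) * delta_coeff c' b' (- 1))
      (mode v (- (?c - c') - 1) (mode u (- (?b - b') - 1) w))) = mode v n (mode u m w)"
    by (subst Sum_any_single[of "(0, 0)"]) (auto simp: delta_coeff_residue split: if_splits)
  have "Sum_any (\<lambda>(a', c'). scale (delta_coeff ?b a' c')
      (mode (mode u (- (- 1 - a') - 1) v) (- (?c - c') - 1) w)) \<in> S"
  proof (rule subspace_Sum_any[OF S], clarify)
    fix a' c' :: int
    show "scale (delta_coeff ?b a' c') (mode (mode u (- (- 1 - a') - 1) v) (- (?c - c') - 1) w) \<in> S"
    proof (cases "0 \<le> a'")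
      case True
      then show ?thesis
        using mem[of "nat a'"] by (auto intro: subspace_scale[OF S])
    next
      case False
      then show ?thesis
        by (simp add: delta_coeff_def subspace_0[OF S])
    qed
  qed
  with jacobi[OF par, of "- 1" ?b ?c] show ?thesis
    unfolding 1 2 by simp
qed

text \<open>Residue of the Jacobi identity in z_1 (exponent b = -1), which isolates (u_l v)_n w. In
  the two expansions of (z_1 - z_2)^l, v acts first with indices at least n, or u acts first with
  indices at least 0.\<close>

lemma iterate_mem:
  assumes par: "u \<in> par \<alpha>" "v \<in> par \<beta>" "w \<in> par \<gamma>" and S: "subspace S"
    and uv: "\<And>i. mode u (l - int i) (mode v (n + int i) w) \<in> S"
    and vu: "\<And>i. mode v (n + l - int i) (mode u (int i) w) \<in> S"
  shows "mode (mode u l v) n w \<in> S"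
proof -
  let ?a = "- l - 1" and ?c = "- n - 1"
  have 1: "Sum_any (\<lambda>(a', c'). scale (delta_coeff (- 1) a' c')
      (mode (mode u (- (?a - a') - 1) v) (- (?c - c') - 1) w)) = mode (mode u l v) n w"
    by (subst Sum_any_single[of "(0, 0)"]) (auto simp: delta_coeff_minus_one split: if_splits)
  have 2: "Sum_any (\<lambda>(b', c'). scale (delta_coeff b' c' ?a)
      (mode u (- (- 1 - b') - 1) (mode v (- (?c - c') - 1) w))) \<in> S"
  proof (rule subspace_Sum_any[OF S], clarify)
    fix b' c' :: int
    show "scale (delta_coeff b' c' ?a) (mode u (- (- 1 - b') - 1) (mode v (- (?c - c') - 1) w)) \<in> S"
    proof (cases "0 \<le> c' \<and> b' + c' = - ?a - 1")
      case True
      then have "- (- 1 - b') - 1 = l - int (nat c')" "- (?c - c') - 1 = n + int (nat c')"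
        by auto
      then show ?thesis
        by (simp only: subspace_scale[OF S uv])
    next
      case False
      then have "delta_coeff b' c' ?a = 0"
        unfolding delta_coeff_def by auto
      then show ?thesis
        by (simp add: subspace_0[OF S])
    qed
  qed
  have 3: "Sum_any (\<lambda>(b', c'). scale ((-1) powi (- ?a - 1) * delta_coeff c' b' ?a)
      (mode v (- (?c - c') - 1) (mode u (- (- 1 - b') - 1) w))) \<in> S"
  proof (rule subspace_Sum_any[OF S], clarify)
    fix b' c' :: int
    show "scale ((-1) powi (- ?a - 1) * delta_coeff c' b' ?a)
      (mode v (- (?c - c') - 1) (mode u (- (- 1 - b') - 1) w)) \<in> S"
    proof (cases "0 \<le> b' \<and> c' + b' = - ?a - 1")
      case True
      then have "- (- 1 - b') - 1 = int (nat b')" "- (?c - c') - 1 = n + l - int (nat b')"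
        by auto
      then show ?thesis
        by (simp only: subspace_scale[OF S vu])
    next
      case False
      then have "delta_coeff c' b' ?a = 0"
        unfolding delta_coeff_def by auto
      then show ?thesis
        by (simp add: subspace_0[OF S])
    qed
  qed
  show ?thesis
    using jacobi[OF par, of ?a "- 1" ?c] subspace_diff[OF S 2 subspace_scale[OF S 3, of "koszul \<alpha>
      \<beta>"]]
    unfolding 1 by simp
qed

end

section \<open>The standard filtration\<close>

context graded_vertex_superalgebra
begin

definition hom_gens :: "'v set \<Rightarrow> ('v \<times> rat \<times> nat) list \<Rightarrow> bool" where
  "hom_gens U ws \<longleftrightarrow>
     (\<forall>(u, d, n) \<in> set ws. n \<ge> 1 \<and> u \<in> U \<and> d \<in> fracN T \<and> u \<in> deg d \<and> (\<exists>\<alpha>. u \<in> par \<alpha>))"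

definition weight :: "('v \<times> rat \<times> nat) list \<Rightarrow> rat" where
  "weight ws = sum_list (map (\<lambda>(u, d, n). d) ws)"

definition hom_monomial :: "('v \<times> rat \<times> nat) list \<Rightarrow> 'v" where
  "hom_monomial ws = monomial (map (\<lambda>(u, d, n). (u, n)) ws)"

lemma filt_eq: "filt U p = span {hom_monomial ws | ws. hom_gens U ws \<and> weight ws \<le> p}"
  by (simp add: filt_def hom_gens_def weight_def hom_monomial_def)

lemma hom_gens_simps [simp]:
  "hom_gens U []"
  "hom_gens U ((u, d, n) # ws) \<longleftrightarrow>
     n \<ge> 1 \<and> u \<in> U \<and> d \<in> fracN T \<and> u \<in> deg d \<and> (\<exists>\<alpha>. u \<in> par \<alpha>) \<and> hom_gens U ws"
  by (auto simp: hom_gens_def)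

lemma weight_simps [simp]: "weight [] = 0" "weight ((u, d, n) # ws) = d + weight ws"
  by (simp_all add: weight_def)

lemma hom_monomial_simps [simp]:
  "hom_monomial [] = vac" "hom_monomial ((u, d, n) # ws) = mode u (- int n) (hom_monomial ws)"
  by (simp_all add: hom_monomial_def monomial_def)

lemma fracN_add: "a \<in> fracN T \<Longrightarrow> b \<in> fracN T \<Longrightarrow> a + b \<in> fracN T"
  unfolding fracN_def by (auto simp flip: add_divide_distrib of_nat_add)

lemma fracN_of_nat: "of_nat n \<in> fracN T"
proof -
  have "of_nat n = (of_nat (n * T) / of_nat T :: rat)"
    using T_pos by simp
  then show ?thesis
    unfolding fracN_def by blast
qed

lemma fracN_0: "0 \<in> fracN T"
  using fracN_of_nat[of 0] by simp

lemma fracN_nonneg: "a \<in> fracN T \<Longrightarrow> 0 \<le> a"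
  by (auto simp: fracN_def)

lemma weight_in_fracN: "hom_gens U ws \<Longrightarrow> weight ws \<in> fracN T"
  by (induction ws) (auto simp: fracN_0 fracN_add)

lemma subspace_filt: "subspace (filt U p)"
  by (simp add: filt_eq)

lemma filt_mono: "p \<le> q \<Longrightarrow> filt U p \<subseteq> filt U q"
  unfolding filt_eq by (rule span_mono) fastforce

lemma hom_monomial_in_filt: "hom_gens U ws \<Longrightarrow> weight ws \<le> p \<Longrightarrow> hom_monomial ws \<in> filt U p"
  unfolding filt_eq by (rule span_base) blast

lemma filt_negative: "p < 0 \<Longrightarrow> filt U p = {0}"
proof -
  assume "p < 0"
  then have "{hom_monomial ws | ws. hom_gens U ws \<and> weight ws \<le> p} = {}"
    using fracN_nonneg weight_in_fracN by force
  then show ?thesis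
    by (simp only: filt_eq span_empty)
qed

lemma hom_monomial_par:
  assumes "hom_gens U ws"
  obtains \<alpha> where "hom_monomial ws \<in> par \<alpha>"
proof -
  have "\<exists>\<alpha>. hom_monomial ws \<in> par \<alpha>"
    using assms
  proof (induction ws)
    case Nil
    then show ?case using vac_even by auto
  next
    case (Cons w ws)
    then show ?case by (cases w) (auto intro: mode_par)
  qed
  then show thesis
    using that by blast
qed

text \<open>The mode of index -n of \<open>u\<close> raises the degree by deg u + n - 1, which is at
  least deg u because n \<ge> 1.\<close>

lemma hom_monomial_deg:
  assumes "hom_gens U ws"
  obtains m where "m \<in> fracN T" "weight ws \<le> m" "hom_monomial ws \<in> deg m"
proof -
  have "\<exists>m\<in>fracN T. weight ws \<le> m \<and> hom_monomial ws \<in> deg m"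
    using assms
  proof (induction ws)
    case Nil
    then show ?case using vac_deg fracN_0 by auto
  next
    case (Cons w ws)
    obtain u d n where w: "w = (u, d, n)"
      by (cases w)
    from Cons obtain m where m: "m \<in> fracN T" "weight ws \<le> m" "hom_monomial ws \<in> deg m"
      by (auto simp: w)
    have u: "d \<in> fracN T" "u \<in> deg d" "n \<ge> 1"
      using Cons.prems by (auto simp: w)
    have eq: "m + d - of_int (- int n) - 1 = m + d + of_nat (n - 1)"
      using u(3) by (simp add: of_nat_diff)
    have "hom_monomial (w # ws) \<in> deg (m + d + of_nat (n - 1))"
      using mode_deg[OF u(1) m(1) u(2) m(3), of "- int n"] unfolding eq by (simp add: w)
    moreover have "m + d + of_nat (n - 1) \<in> fracN T"
      by (intro fracN_add m u fracN_of_nat)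
    moreover have "weight (w # ws) \<le> m + d + of_nat (n - 1)"
      using m(2) by (simp add: w)
    ultimately show ?case
      by blast
  qed
  then show thesis
    using that by blast
qed

lemma mode_generator_filt:
  assumes "u \<in> U" "d \<in> fracN T" "u \<in> deg d" "u \<in> par \<alpha>" "n \<ge> 1" "y \<in> filt U q" "d + q \<le> r"
  shows "mode u (- int n) y \<in> filt U r"
proof (rule mode_span[OF subspace_filt])
  show "u \<in> span {u}"
    by (simp add: span_base)
  show "y \<in> span {hom_monomial ws | ws. hom_gens U ws \<and> weight ws \<le> q}"
    using assms(6) by (simp add: filt_eq)
  fix a b
  assume "a \<in> {u}" "b \<in> {hom_monomial ws | ws. hom_gens U ws \<and> weight ws \<le> q}"
  then obtain ws where ws: "a = u" "b = hom_monomial ws" "hom_gens U ws" "weight ws \<le> q"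
    by blast
  have "hom_monomial ((u, d, n) # ws) \<in> filt U r"
    using assms ws by (intro hom_monomial_in_filt) auto
  then show "mode a (- int n) b \<in> filt U r"
    by (simp add: ws)
qed

text \<open>\<open>U\<close> is compatible with parity and with degree separately. For v in
  \<open>U\<close> of parity \<alpha>, the degree decompositions inside \<open>U\<close> and inside
  \<open>par \<alpha>\<close> both are the one in V, so they agree and their members are homogeneous
  in both senses.\<close>

lemma homogeneous_parts_of_subsuperspace:
  assumes U: "graded_subsuperspace U" and u: "u \<in> U"
  shows "u \<in> span {h \<in> U. \<exists>d\<in>fracN T. \<exists>\<alpha>. h \<in> deg d \<and> h \<in> par \<alpha>}" (is "_ \<in> span ?H")
proof -
  have Up: "direct_sum UNIV (\<lambda>\<alpha>. U \<inter> par \<alpha>) U" and Ud: "direct_sum (fracN T) (\<lambda>n. U \<inter> deg n) U"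
    using U by (auto simp: graded_subsuperspace_def)
  have *: "v \<in> span ?H" if v: "v \<in> U" "v \<in> par \<alpha>" for v \<alpha>
  proof -
    let ?f = "component (fracN T) (\<lambda>n. U \<inter> deg n) v"
    let ?g = "component (fracN T) (\<lambda>n. par \<alpha> \<inter> deg n) v"
    have f: "component (fracN T) deg v = ?f"
      by (rule component_unique[OF deg_sum])
        (use component_in[OF Ud v(1)] component_outside[OF Ud v(1)] finite_component[OF Ud v(1)]
          Sum_any_component[OF Ud v(1)] in auto)
    have g: "component (fracN T) deg v = ?g"
      by (rule component_unique[OF deg_sum])
        (use component_in[OF par_deg_sum v(2)] component_outside[OF par_deg_sum v(2)]
          finite_component[OF par_deg_sum v(2)] Sum_any_component[OF par_deg_sum v(2)] in auto)
    have "?f n \<in> span ?H" for n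
    proof (cases "n \<in> fracN T")
      case True
      then have "?f n \<in> U \<inter> deg n" "?g n \<in> par \<alpha>"
        using component_in[OF Ud v(1)] component_in[OF par_deg_sum v(2)] by blast+
      with True f g show ?thesis
        by (intro span_base) auto
    next
      case False
      then show ?thesis
        by (simp add: component_outside[OF Ud v(1)] span_zero)
    qed
    then have "Sum_any ?f \<in> span ?H"
      by (intro subspace_Sum_any) auto
    then show ?thesis
      by (simp only: Sum_any_component[OF Ud v(1)])
  qed
  have "component UNIV (\<lambda>\<alpha>. U \<inter> par \<alpha>) u \<alpha> \<in> span ?H" for \<alpha>
    using component_in[OF Up u, of \<alpha>] by (intro *[of _ \<alpha>]) auto
  then have "Sum_any (component UNIV (\<lambda>\<alpha>. U \<inter> par \<alpha>) u) \<in> span ?H"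
    by (intro subspace_Sum_any) auto
  then show ?thesis
    by (simp only: Sum_any_component[OF Up u])
qed

text \<open>Strong generation allows arbitrary generators from \<open>U\<close>, the filtration only
  homogeneous ones. Multilinear expansion closes this gap, which also makes the filtration
  exhaustive.\<close>

lemma span_hom_monomials:
  assumes U: "graded_subsuperspace U" "strongly_generated_by U"
  shows "span {hom_monomial ws | ws. hom_gens U ws} = UNIV" (is "span ?M = UNIV")
proof -
  have "monomial ws \<in> span ?M" if "\<forall>(u, n) \<in> set ws. u \<in> U \<and> n \<ge> 1" for ws
    using that
  proof (induction ws)
    case Nil
    have "hom_monomial [] \<in> span ?M"
      by (intro span_base) (use hom_gens_simps(1) in blast)
    then show ?case
      by (simp add: monomial_def)
  next
    case (Cons w ws)
    obtain u n where w: "w = (u, n)"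
      by fastforce
    have "mode u (- int n) (monomial ws) \<in> span ?M"
    proof (rule mode_span[OF subspace_span])
      show "u \<in> span {h \<in> U. \<exists>d\<in>fracN T. \<exists>\<alpha>. h \<in> deg d \<and> h \<in> par \<alpha>}"
        using Cons.prems by (intro homogeneous_parts_of_subsuperspace U) (auto simp: w)
      show "monomial ws \<in> span ?M"
        using Cons by auto
      fix a b
      assume "a \<in> {h \<in> U. \<exists>d\<in>fracN T. \<exists>\<alpha>. h \<in> deg d \<and> h \<in> par \<alpha>}" "b \<in> ?M"
      then obtain d \<alpha> vs where a: "a \<in> U" "d \<in> fracN T" "a \<in> deg d" "a \<in> par \<alpha>"
        "b = hom_monomial vs" "hom_gens U vs"
        by blast
      then have "hom_gens U ((a, d, n) # vs)"
        using Cons.prems by (auto simp: w)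
      moreover have "mode a (- int n) b = hom_monomial ((a, d, n) # vs)"
        by (simp add: a)
      ultimately show "mode a (- int n) b \<in> span ?M"
        by (intro span_base) blast
    qed
    then show ?case
      by (simp add: w monomial_def)
  qed
  then have "{monomial ws | ws. \<forall>(u, n) \<in> set ws. u \<in> U \<and> n \<ge> 1} \<subseteq> span ?M"
    by blast
  then have "span {monomial ws | ws. \<forall>(u, n) \<in> set ws. u \<in> U \<and> n \<ge> 1} \<subseteq> span ?M"
    by (rule span_minimal) simp
  then show ?thesis
    using U(2) by (auto simp: strongly_generated_by_def)
qed

text \<open>Projection to degree \<open>m\<close> either kills a monomial or fixes it, and in the
  second case its weight is at most \<open>m\<close>. This bounds the level of vectors that are not
  presented as monomials.\<close>

lemma deg_subset_filt:
  assumes U: "graded_subsuperspace U" "strongly_generated_by U"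
  shows "deg m \<subseteq> filt U m"
proof (cases "m \<in> fracN T")
  case m: True
  let ?c = "component (fracN T) deg"
  have c_add: "?c (x + y) m = ?c x m + ?c y m" and c_scale: "?c (scale a x) m = scale a (?c x m)"
    for x y a
    by (simp_all add: component_add[OF deg_sum] component_scale[OF deg_sum])
  have c_0: "?c 0 m = 0"
    using c_scale[of 0 0] by simp
  have "subspace {v. ?c v m \<in> filt U m}"
    by (rule subspaceI) (auto simp: c_0 c_add c_scale subspace_0 subspace_add subspace_scale
      subspace_filt)
  moreover have "hom_monomial ws \<in> {v. ?c v m \<in> filt U m}" if ws: "hom_gens U ws" for ws
  proof -
    obtain k where k: "k \<in> fracN T" "weight ws \<le> k" "hom_monomial ws \<in> deg k"
      using hom_monomial_deg[OF ws] .
    have "?c (hom_monomial ws) m = (if m = k then hom_monomial ws else 0)"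
      by (simp add: component_of_summand[where S = deg, OF deg_sum k(3,1)])
    then show ?thesis
      using k ws by (auto simp: subspace_0[OF subspace_filt] hom_monomial_in_filt)
  qed
  ultimately have "span {hom_monomial ws | ws. hom_gens U ws} \<subseteq> {v. ?c v m \<in> filt U m}"
    by (intro span_minimal) auto
  then have c: "?c v m \<in> filt U m" for v
    using span_hom_monomials[OF U] by auto
  show ?thesis
  proof
    fix v assume "v \<in> deg m"
    then have "?c v m = v"
      using component_of_summand[where S = deg, OF deg_sum _ m] by simp
    with c[of v] show "v \<in> filt U m"
      by simp
  qed
next
  case False
  then show ?thesis
    by (simp add: deg_outside subspace_0[OF subspace_filt])
qed

text \<open>Induction on the total weight in units of 1/T, then on the left monomial. The iterate
  formula leaves u_(-n-i) applied after a product with a shorter left word, or a product with u_i v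
  for i \<ge> 0, whose total weight has dropped by 1.\<close>

lemma mode_filt:
  assumes U: "graded_subsuperspace U" "strongly_generated_by U"
    and x: "x \<in> filt U p" and y: "y \<in> filt U q"
  shows "mode x k y \<in> filt U (p + q)"
proof -
  have main: "mode (hom_monomial ws) k (hom_monomial vs) \<in> filt U (weight ws + weight vs)"
    if "weight ws + weight vs = of_nat K / of_nat T" "hom_gens U ws" "hom_gens U vs" for K ws vs k
    using that
  proof (induction K arbitrary: ws vs k rule: less_induct)
    case (less K)
    define D :: rat where "D = of_nat K / of_nat T"
    \<comment> \<open>The induction hypothesis, extended bilinearly from monomials to all elements
      of the filtration.\<close>
    have below: "mode x k y \<in> filt U (p + q)"
      if "x \<in> filt U p" "y \<in> filt U q" "p + q < D" for x y p q k
    proof (rule mode_span[OF subspace_filt])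
      show "x \<in> span {hom_monomial ws | ws. hom_gens U ws \<and> weight ws \<le> p}"
        "y \<in> span {hom_monomial ws | ws. hom_gens U ws \<and> weight ws \<le> q}"
        using that by (simp_all add: filt_eq)
      fix a b
      assume "a \<in> {hom_monomial ws | ws. hom_gens U ws \<and> weight ws \<le> p}"
        "b \<in> {hom_monomial ws | ws. hom_gens U ws \<and> weight ws \<le> q}"
      then obtain as bs where ab: "a = hom_monomial as" "hom_gens U as" "weight as \<le> p"
        "b = hom_monomial bs" "hom_gens U bs" "weight bs \<le> q"
        by blast
      have "weight as + weight bs \<in> fracN T"
        by (intro fracN_add weight_in_fracN[OF ab(2)] weight_in_fracN[OF ab(5)])
      then obtain L where L: "weight as + weight bs = of_nat L / of_nat T"
        by (auto simp: fracN_def)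
      have "(of_nat L / of_nat T :: rat) < of_nat K / of_nat T"
        using ab that(3) L unfolding D_def by linarith
      then have "L < K"
        using T_pos by (simp add: divide_less_cancel)
      from less.IH[OF this L ab(2,5)] ab(1,4) filt_mono[of "weight as + weight bs" "p
        + q" U] ab(3,6)
      show "mode a k b \<in> filt U (p + q)"
        by auto
    qed
    \<comment> \<open>Move a_j to the right until it annihilates the vacuum. Each commutator
      contributes terms (a_i b)_k with i \<ge> 0; here a_i b has degree at most d + e - 1, so
      \<open>deg_subset_filt\<close> and \<open>below\<close> apply.\<close>
    have positive: "mode a (int j) (hom_monomial vs) \<in> filt U (d + weight vs - 1)"
      if a: "a \<in> U" "d \<in> fracN T" "a \<in> deg d" "a \<in> par \<alpha>"
        and "hom_gens U vs" "d + weight vs \<le> D" for a d \<alpha> j vs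
      using that(5,6)
    proof (induction vs)
      case Nil
      then show ?case
        by (simp add: mode_vac subspace_0[OF subspace_filt])
    next
      case (Cons v vs)
      obtain b e n where v: "v = (b, e, n)"
        by (cases v)
      from Cons.prems obtain \<beta> where b: "n \<ge> 1" "b \<in> U" "e \<in> fracN T" "b \<in> deg e" "b \<in> par \<beta>"
        and vs: "hom_gens U vs"
        by (auto simp: v)
      obtain \<gamma> where par: "hom_monomial vs \<in> par \<gamma>"
        using hom_monomial_par[OF vs] .
      let ?S = "filt U (d + (e + weight vs) - 1)"
      have "mode (mode a (int i) b) k (hom_monomial vs) \<in> ?S" for i k
      proof -
        have "mode a (int i) b \<in> deg (e + d - of_int (int i) - 1)"
          by (rule mode_deg[OF a(2) b(3) a(3) b(4)])
        then have "mode a (int i) b \<in> filt U (d + e - 1)"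
          using deg_subset_filt[OF U] filt_mono[of "e + d - of_int (int i) - 1" "d + e - 1" U]
            by fastforce
        moreover have "hom_monomial vs \<in> filt U (weight vs)"
          by (simp add: hom_monomial_in_filt vs)
        ultimately have "mode (mode a (int i) b) k (hom_monomial vs) \<in> filt U (d + e - 1
          + weight vs)"
          by (rule below) (use Cons.prems in \<open>simp add: v\<close>)
        then show ?thesis
          by (simp add: algebra_simps)
      qed
      from commutator_mem[OF a(4) b(5) par subspace_filt this]
      have comm: "mode a (int j) (mode b (- int n) (hom_monomial vs))
        - scale (koszul \<alpha> \<beta>) (mode b (- int n) (mode a (int j) (hom_monomial vs))) \<in> ?S" .
      have "mode a (int j) (hom_monomial vs) \<in> filt U (d + weight vs - 1)"
        using Cons.prems fracN_nonneg[OF b(3)] by (intro Cons.IH) (auto simp: v)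
      then have "mode b (- int n) (mode a (int j) (hom_monomial vs)) \<in> ?S"
        by (rule mode_generator_filt[OF b(2-5) b(1)]) simp
      from subspace_add[OF subspace_filt comm subspace_scale[OF subspace_filt this, of "koszul \<alpha>
        \<beta>"]]
      show ?case
        by (simp add: v)
    qed
    have "mode (hom_monomial ws) k (hom_monomial vs) \<in> filt U (weight ws + weight vs)"
      if "hom_gens U ws" "weight ws + weight vs \<le> D" for ws k
      using that
    proof (induction ws arbitrary: k)
      case Nil
      then show ?case
        by (simp add: vac_mode subspace_0[OF subspace_filt] hom_monomial_in_filt[OF less.prems(3)])
    next
      case (Cons w ws)
      obtain u d n where w: "w = (u, d, n)"
        by (cases w)
      from Cons.prems obtain \<alpha> where u: "n \<ge> 1" "u \<in> U" "d \<in> fracN T" "u \<in> deg d" "u \<in> par \<alpha>"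
        and ws: "hom_gens U ws"
        by (auto simp: w)
      obtain \<beta> \<gamma> where par: "hom_monomial ws \<in> par \<beta>" "hom_monomial vs \<in> par \<gamma>"
        using hom_monomial_par[OF ws] hom_monomial_par[OF less.prems(3)] by metis
      have nonneg: "0 \<le> weight ws" "0 \<le> d"
        using fracN_nonneg weight_in_fracN ws u(3) by blast+
      have le: "d + weight ws + weight vs \<le> D"
        using Cons.prems by (simp add: w)
      have "mode (mode u (- int n) (hom_monomial ws)) k (hom_monomial vs) \<in> filt U (d + weight ws
        + weight vs)"
      proof (rule iterate_mem[OF u(5) par subspace_filt])
        fix i
        have "mode (hom_monomial ws) (k + int i) (hom_monomial vs) \<in> filt U (weight ws + weight vs)"
          using nonneg le by (intro Cons.IH ws) simp
        then have "mode u (- int (n + i)) (mode (hom_monomial ws) (k + int i) (hom_monomial vs))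
          \<in> filt U (d + weight ws + weight vs)"
          by (rule mode_generator_filt[OF u(2-5), where q = "weight ws + weight vs", rotated])
            (use u(1) in simp_all)
        moreover have "- int (n + i) = - int n - int i"
          by simp
        ultimately show "mode u (- int n - int i) (mode (hom_monomial ws) (k
          + int i) (hom_monomial vs))
          \<in> filt U (d + weight ws + weight vs)"
          by (simp only:)
        \<comment> \<open>The drop by 1 places the second kind of term below the current weight,
          although \<open>ws\<close> here is not applied to a monomial.\<close>
        have "mode u (int i) (hom_monomial vs) \<in> filt U (d + weight vs - 1)"
          using le nonneg by (intro positive[OF u(2-5) less.prems(3)]) simp
        moreover have "hom_monomial ws \<in> filt U (weight ws)"
          by (simp add: hom_monomial_in_filt ws)
        ultimately have "mode (hom_monomial ws) (k
          + - int n - int i) (mode u (int i) (hom_monomial vs))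
          \<in> filt U (weight ws + (d + weight vs - 1))"
          using le by (intro below) auto
        then show "mode (hom_monomial ws) (k + - int n - int i) (mode u (int i) (hom_monomial vs))
          \<in> filt U (d + weight ws + weight vs)"
          using filt_mono[of "weight ws + (d + weight vs - 1)" "d + weight ws + weight vs" U]
            by auto
      qed
      then show ?case
        by (simp add: w)
    qed
    from this[OF less.prems(2)] show ?case
      using less.prems(1) by (simp add: D_def)
  qed
  show ?thesis
  proof (rule mode_span[OF subspace_filt])
    show "x \<in> span {hom_monomial ws | ws. hom_gens U ws \<and> weight ws \<le> p}"
      "y \<in> span {hom_monomial ws | ws. hom_gens U ws \<and> weight ws \<le> q}"
      using x y by (simp_all add: filt_eq)
    fix a b
    assume "a \<in> {hom_monomial ws | ws. hom_gens U ws \<and> weight ws \<le> p}"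
      "b \<in> {hom_monomial ws | ws. hom_gens U ws \<and> weight ws \<le> q}"
    then obtain as bs where ab: "a = hom_monomial as" "hom_gens U as" "weight as \<le> p"
      "b = hom_monomial bs" "hom_gens U bs" "weight bs \<le> q"
      by blast
    have "weight as + weight bs \<in> fracN T"
      by (intro fracN_add weight_in_fracN[OF ab(2)] weight_in_fracN[OF ab(5)])
    then obtain L where "weight as + weight bs = of_nat L / of_nat T"
      by (auto simp: fracN_def)
    from main[OF this ab(2,5)] ab filt_mono[of "weight as + weight bs" "p + q" U]
    show "mode a k b \<in> filt U (p + q)"
      by auto
  qed
qed

end

section \<open>Quotients\<close>

lemma (in module) coset_eq_iff:
  assumes W: "subspace W"
  shows "coset W x = coset W y \<longleftrightarrow> x - y \<in> W"
proof
  have "x + 0 \<in> coset W x"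
    unfolding coset_def using subspace_0[OF W] by blast
  moreover assume "coset W x = coset W y"
  ultimately have "x \<in> coset W y"
    by simp
  then show "x - y \<in> W"
    by (auto simp: coset_def)
next
  assume xy: "x - y \<in> W"
  show "coset W x = coset W y"
  proof (intro set_eqI iffI)
    fix z assume "z \<in> coset W x"
    then obtain w where "w \<in> W" "z = y + ((x - y) + w)"
      by (auto simp: coset_def algebra_simps)
    then show "z \<in> coset W y"
      using subspace_add[OF W xy] unfolding coset_def by blast
  next
    fix z assume "z \<in> coset W y"
    then obtain w where "w \<in> W" "z = x + (w - (x - y))"
      by (auto simp: coset_def algebra_simps)
    then show "z \<in> coset W x"
      using subspace_diff[OF W _ xy] unfolding coset_def by blast
  qed
qed

lemma (in module) rep_coset:
  assumes W: "subspace W"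
  shows "rep (coset W x) - x \<in> W"
proof -
  have "x + 0 \<in> coset W x"
    unfolding coset_def using subspace_0[OF W] by blast
  then have "rep (coset W x) \<in> coset W x"
    unfolding rep_def by (rule someI)
  then show ?thesis
    by (auto simp: coset_def)
qed

lemma (in module) coset_rep:
  assumes W: "subspace W"
  shows "coset W (rep (coset W x)) = coset W x"
  by (simp add: coset_eq_iff[OF W] rep_coset[OF W])

interpretation fscale: vector_space fscale
  by (rule vector_space_fscale)

lemma subspace_fock_ideal: "fscale.subspace (fock_ideal hscale hpar)"
proof (rule fscale.subspaceI)
  show "0 \<in> fock_ideal hscale hpar"
    by (simp add: fock_ideal_def two_sided_ideal.zero)
  show "x + y \<in> fock_ideal hscale hpar" if "x \<in> fock_ideal hscale hpar" "y
    \<in> fock_ideal hscale hpar" for x y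
    using that by (simp add: fock_ideal_def two_sided_ideal.sum)
  show "fscale c x \<in> fock_ideal hscale hpar" if "x \<in> fock_ideal hscale hpar" for c x
    using that unfolding fock_ideal_def
  proof induction
    case (base r a b)
    \<comment> \<open>The inductive definition has no rule for scalars, so they are absorbed into
      the left factor.\<close>
    then have "fscale c a * r * b \<in> two_sided_ideal (fock_relations hscale hpar)"
      by (rule two_sided_ideal.base)
    then show ?case
      by (simp add: fscale_mult_left)
  qed (auto simp: fscale_add intro: two_sided_ideal.intros)
qed

section \<open>Bases adapted to a filtration\<close>

text \<open>Bases of the successive steps are extended one into the next, and \<open>lev\<close> is
  the stage at which a vector first appears. The members of level k then form a basis of
  \<open>E k\<close> modulo the previous step, so coordinates can be read off in the graded
  pieces.\<close>

lemma (in vector_space) filtered_basis: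
  fixes E :: "nat \<Rightarrow> 'b set"
  assumes E: "\<And>k. E k \<subseteq> E (Suc k)" "\<And>k. subspace (E k)"
  obtains B lev where "independent B" "\<And>k. span {b \<in> B. lev b \<le> k} = E k"
proof -
  have "\<exists>A. \<forall>k. (independent (A k) \<and> A k \<subseteq> E k \<and> E k \<subseteq> span (A k)) \<and> A k \<subseteq> A (Suc k)"
  proof (rule dependent_nat_choice[where P = "\<lambda>k A. independent A \<and> A \<subseteq> E k \<and> E k \<subseteq> span A"
        and Q = "\<lambda>k. (\<subseteq>)"])
    obtain A where "{} \<subseteq> A" "A \<subseteq> E 0" "independent A" "E 0 \<subseteq> span A"
      by (rule maximal_independent_subset_extend[OF empty_subsetI independent_empty])
    then show "\<exists>A. independent A \<and> A \<subseteq> E 0 \<and> E 0 \<subseteq> span A"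
      by blast
    fix A k
    assume "independent A \<and> A \<subseteq> E k \<and> E k \<subseteq> span A"
    then have "A \<subseteq> E (Suc k)" "independent A"
      using E(1)[of k] by blast+
    then obtain A' where "A \<subseteq> A'" "A' \<subseteq> E (Suc k)" "independent A'" "E (Suc k) \<subseteq> span A'"
      by (rule maximal_independent_subset_extend)
    then show "\<exists>A'. (independent A' \<and> A' \<subseteq> E (Suc k) \<and> E (Suc k) \<subseteq> span A') \<and> A \<subseteq> A'"
      by blast
  qed
  then obtain A where "\<forall>k. (independent (A k) \<and> A k \<subseteq> E k \<and> E k \<subseteq> span (A k)) \<and> A k \<subseteq> A (Suc k)" ..
  then have A: "\<And>k. independent (A k)" "\<And>k. A k \<subseteq> E k" "\<And>k. E k \<subseteq> span (A k)"
    and mono: "\<And>k. A k \<subseteq> A (Suc k)"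
    by simp_all
  have mono: "A j \<subseteq> A k" if "j \<le> k" for j k
    using that by (rule lift_Suc_mono_le[of A, OF mono])
  define lev where "lev b = (LEAST k. b \<in> A k)" for b
  have lev: "{b \<in> \<Union>(range A). lev b \<le> k} = A k" for k
  proof (intro set_eqI iffI)
    fix b assume "b \<in> {b \<in> \<Union>(range A). lev b \<le> k}"
    then obtain j where "b \<in> A j" "lev b \<le> k"
      by auto
    from \<open>b \<in> A j\<close> have "b \<in> A (lev b)"
      unfolding lev_def by (rule LeastI)
    with mono[OF \<open>lev b \<le> k\<close>] show "b \<in> A k"
      by blast
  qed (auto simp: lev_def intro: Least_le)
  show thesis
  proof (rule that)
    show "independent (\<Union>(range A))"
    proof (rule independent_Union_directed)
      fix c d assume "c \<in> range A" "d \<in> range A"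
      then obtain i j where "c = A i" "d = A j"
        by blast
      then show "c \<subseteq> d \<or> d \<subseteq> c"
        using mono[of i j] mono[of j i] nat_le_linear[of i j] by blast
    qed (use A in auto)
    show "span {b \<in> \<Union>(range A). lev b \<le> k} = E k" for k
      unfolding lev using A(2,3)[of k] span_minimal[OF A(2) E(2)] by blast
  qed
qed

section \<open>Homogeneous elements of the associated graded algebra\<close>

context graded_vertex_superalgebra
begin

definition gr_elem :: "'v set \<Rightarrow> rat \<Rightarrow> 'v \<Rightarrow> rat \<Rightarrow> 'v set" where
  "gr_elem U p x = (\<lambda>q\<in>fracN T. coset (filt_pred U q) (if q = p then x else 0))"

lemma filt_pred_subset: "filt_pred U p \<subseteq> filt U p"
  by (rule filt_mono) simp

lemma gr_elem_in_carrier: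
  assumes "x \<in> filt U p"
  shows "gr_elem U p x \<in> gr_carrier U"
proof -
  have "gr_elem U p x \<in> (\<Pi>\<^sub>E q\<in>fracN T. coset (filt_pred U q) ` filt U q)"
    using assms by (auto simp: gr_elem_def subspace_0[OF subspace_filt])
  moreover have "finite {q \<in> fracN T. gr_elem U p x q \<noteq> coset (filt_pred U q) 0}"
    by (rule finite_subset[of _ "{p}"]) (auto simp: gr_elem_def)
  ultimately show ?thesis
    by (simp add: gr_carrier_def)
qed

lemma gr_elem_eq_0: "x \<in> filt_pred U p \<Longrightarrow> gr_elem U p x = gr_elem U p 0"
  by (auto simp: gr_elem_def fun_eq_iff restrict_def coset_eq_iff[OF subspace_filt] subspace_0[OF
    subspace_filt])

lemma gr_elem_add: "vsa.add (gr U) (gr_elem U p x) (gr_elem U p y) = gr_elem U p (x + y)"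
proof
  fix q
  let ?W = "filt_pred U q"
  have "coset ?W (rep (coset ?W a) + rep (coset ?W b)) = coset ?W (a + b)" for a b
    using subspace_add[OF subspace_filt rep_coset[OF subspace_filt] rep_coset[OF subspace_filt],
      of U "q - 1 / of_nat T" a b]
    by (simp add: coset_eq_iff[OF subspace_filt] algebra_simps)
  then show "vsa.add (gr U) (gr_elem U p x) (gr_elem U p y) q = gr_elem U p (x + y) q"
    by (simp add: gr_def gr_elem_def restrict_def)
qed

lemma gr_elem_smult: "vsa.smult (gr U) c (gr_elem U p x) = gr_elem U p (scale c x)"
proof
  fix q
  let ?W = "filt_pred U q"
  have "coset ?W (scale c (rep (coset ?W a))) = coset ?W (scale c a)" for a
    using subspace_scale[OF subspace_filt rep_coset[OF subspace_filt[of U "q - 1 / of_nat T"]], of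
      c a]
    by (simp add: coset_eq_iff[OF subspace_filt] scale_right_diff_distrib)
  then show "vsa.smult (gr U) c (gr_elem U p x) q = gr_elem U p (scale c x) q"
    by (simp add: gr_def gr_elem_def restrict_def)
qed

text \<open>Needed because the product in \<open>gr\<close> sums over these pairs, and a sum over an
  infinite set would be 0 by convention.\<close>

lemma finite_fracN_pairs: "finite {(p, q). p \<in> fracN T \<and> q \<in> fracN T \<and> p + q = r}"
proof -
  obtain N :: nat where N: "r * of_nat T < of_nat N"
    using reals_Archimedean2 by blast
  have "(p, q) \<in> (\<lambda>k. (of_nat k / of_nat T, r - of_nat k / of_nat T)) ` {..N}"
    if p: "p \<in> fracN T" and q: "q \<in> fracN T" and r: "p + q = r" for p q
  proof -
    obtain k where k: "p = of_nat k / of_nat T"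
      using p by (auto simp: fracN_def)
    have "of_nat k / of_nat T \<le> r"
      using fracN_nonneg[OF q] r k by simp
    then have "(of_nat k :: rat) \<le> r * of_nat T"
      using T_pos by (simp add: divide_le_eq)
    then have "(of_nat k :: rat) < of_nat N"
      using N by linarith
    then have "k \<le> N"
      by simp
    moreover have "(p, q) = (of_nat k / of_nat T, r - of_nat k / of_nat T)"
      using k r by auto
    ultimately show ?thesis
      by blast
  qed
  then have "{(p, q). p \<in> fracN T \<and> q \<in> fracN T \<and> p + q = r}
      \<subseteq> (\<lambda>k. (of_nat k / of_nat T, r - of_nat k / of_nat T)) ` {..N}"
    by blast
  then show ?thesis
    by (rule finite_subset) simp
qed

lemma gr_elem_product:
  assumes U: "graded_subsuperspace U" "strongly_generated_by U"
    and pq: "p \<in> fracN T" "q \<in> fracN T" and x: "x \<in> filt U p" and y: "y \<in> filt U q"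
  shows "vsa.product (gr U) (gr_elem U p x) n (gr_elem U q y) = gr_elem U (p + q) (mode x n y)"
proof
  fix r
  show "vsa.product (gr U) (gr_elem U p x) n (gr_elem U q y) r = gr_elem U (p + q) (mode x n y) r"
  proof (cases "r \<in> fracN T")
    case r: True
    let ?P = "{(p, q). p \<in> fracN T \<and> q \<in> fracN T \<and> p + q = r}"
    let ?x = "\<lambda>p'. if p' = p then x else 0" and ?y = "\<lambda>q'. if q' = q then y else 0"
    let ?rx = "\<lambda>p'. rep (coset (filt_pred U p') (?x p'))" and ?ry
      = "\<lambda>q'. rep (coset (filt_pred U q') (?y q'))"
    \<comment> \<open>With primes for representatives, x'y' - xy = (x' - x)y' + x(y' - y), and by
      \<open>mode_filt\<close> each term lies one step lower.\<close>
    have diff: "mode (?rx p') n (?ry q') - mode (?x p') n (?y q') \<in> filt_pred U r" if "p' + q'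
      = r" for p' q'
    proof -
      have xr: "?rx p' - ?x p' \<in> filt_pred U p'" and yr: "?ry q' - ?y q' \<in> filt_pred U q'"
        by (rule rep_coset[OF subspace_filt])+
      have x': "?x p' \<in> filt U p'"
        using x by (simp add: subspace_0[OF subspace_filt])
      have "?y q' \<in> filt U q'"
        using y by (simp add: subspace_0[OF subspace_filt])
      from subspace_add[OF subspace_filt this subsetD[OF filt_pred_subset yr]]
      have y': "?ry q' \<in> filt U q'"
        by simp
      have eq: "p' - 1 / of_nat T + q' = r - 1 / of_nat T" "p' + (q' - 1 / of_nat T)
        = r - 1 / of_nat T"
        using that by simp_all
      from subspace_add[OF subspace_filt mode_filt[OF U xr y', unfolded eq] mode_filt[OF U x' yr,
        unfolded eq], of n n]
      show ?thesis
        using mode_add_left[of "?rx p' - ?x p'" "?x p'" n "?ry q'"]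
          mode_add_right[of "?x p'" n "?ry q' - ?y q'" "?y q'"]
        by (simp only: diff_add_cancel) (simp add: algebra_simps)
    qed
    have "(\<Sum>(p', q')\<in>?P. mode (?rx p') n (?ry q')) - (\<Sum>(p', q')\<in>?P. mode (?x p') n (?y q'))
      = (\<Sum>(p', q')\<in>?P. mode (?rx p') n (?ry q') - mode (?x p') n (?y q'))"
      by (simp add: sum_subtractf case_prod_beta)
    also have "\<dots> \<in> filt_pred U r"
      using diff by (intro subspace_sum[OF subspace_filt]) auto
    also have "(\<Sum>(p', q')\<in>?P. mode (?x p') n (?y q')) = (if r = p + q then mode x n y else 0)"
    proof -
      have "(\<Sum>(p', q')\<in>?P. mode (?x p') n (?y q')) = (\<Sum>z\<in>?P. if z = (p, q) then mode x n y else 0)"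
        by (intro sum.cong) (auto split: if_splits)
      also have "\<dots> = (if (p, q) \<in> ?P then mode x n y else 0)"
        by (rule sum.delta[OF finite_fracN_pairs])
      finally show ?thesis
        using pq by auto
    qed
    finally have "coset (filt_pred U r) (\<Sum>(p', q')\<in>?P. mode (?rx p') n (?ry q'))
      = coset (filt_pred U r) (if r = p + q then mode x n y else 0)"
      by (simp only: coset_eq_iff[OF subspace_filt])
    moreover have "(\<Sum>(p', q')\<in>?P. mode (rep (gr_elem U p x p')) n (rep (gr_elem U q y q')))
        = (\<Sum>(p', q')\<in>?P. mode (?rx p') n (?ry q'))"
      by (intro sum.cong) (auto simp: gr_elem_def)
    ultimately show ?thesis
      using r fracN_add[OF pq] by (simp add: gr_def) (simp add: gr_elem_def)
  qed (simp add: gr_def gr_elem_def)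
qed

lemma rep_gr_carrier:
  assumes "f \<in> gr_carrier U" "p \<in> fracN T"
  shows "rep (f p) \<in> filt U p" "coset (filt_pred U p) (rep (f p)) = f p"
proof -
  have "f p \<in> coset (filt_pred U p) ` filt U p"
    using assms by (auto simp: gr_carrier_def)
  then obtain x where x: "x \<in> filt U p" "f p = coset (filt_pred U p) x"
    by blast
  have "x + (rep (f p) - x) \<in> filt U p"
    using subsetD[OF filt_pred_subset rep_coset[OF subspace_filt]]
    unfolding x(2) by (intro subspace_add[OF subspace_filt] x(1)) blast
  then show "rep (f p) \<in> filt U p"
    by simp
  show "coset (filt_pred U p) (rep (f p)) = f p"
    unfolding x(2) by (rule coset_rep[OF subspace_filt])
qed

text \<open>An isomorphism is constrained only on carriers, so closure, including finite support, is
  required before its inverse can be applied to a sum.\<close>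

lemma gr_carrier_add:
  assumes f: "f \<in> gr_carrier U" and g: "g \<in> gr_carrier U"
  shows "vsa.add (gr U) f g \<in> gr_carrier U"
proof -
  have "vsa.add (gr U) f g \<in> (\<Pi>\<^sub>E q\<in>fracN T. coset (filt_pred U q) ` filt U q)"
    using rep_gr_carrier(1)[OF f] rep_gr_carrier(1)[OF g]
    by (auto simp: gr_def subspace_add[OF subspace_filt])
  moreover have "{q \<in> fracN T. vsa.add (gr U) f g q \<noteq> coset (filt_pred U q) 0}
    \<subseteq> {q \<in> fracN T. f q \<noteq> coset (filt_pred U q) 0} \<union> {q \<in> fracN T. g q \<noteq> coset (filt_pred U q) 0}"
  proof (rule subsetI, rule ccontr)
    fix q
    assume "q \<in> {q \<in> fracN T. vsa.add (gr U) f g q \<noteq> coset (filt_pred U q) 0}"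
      and "q \<notin> {q \<in> fracN T. f q \<noteq> coset (filt_pred U q) 0} \<union> {q
        \<in> fracN T. g q \<noteq> coset (filt_pred U q) 0}"
    then have q: "q \<in> fracN T" "g q = coset (filt_pred U q) 0" and f0: "f q
      = coset (filt_pred U q) 0"
      and ne: "vsa.add (gr U) f g q \<noteq> coset (filt_pred U q) 0"
      by auto
    have "rep (f q) + rep (g q) \<in> filt_pred U q"
      using rep_coset[OF subspace_filt, of U "q - 1 / of_nat T" 0]
      unfolding q f0 by (intro subspace_add[OF subspace_filt]) simp_all
    then have "vsa.add (gr U) f g q = coset (filt_pred U q) 0"
      using q by (simp add: gr_def coset_eq_iff[OF subspace_filt])
    with ne show False
      by simp
  qed
  then have "finite {q \<in> fracN T. vsa.add (gr U) f g q \<noteq> coset (filt_pred U q) 0}"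
    by (rule finite_subset) (use f g in \<open>auto simp: gr_carrier_def\<close>)
  ultimately show ?thesis
    by (simp add: gr_carrier_def)
qed

lemma gr_carrier_smult:
  assumes f: "f \<in> gr_carrier U"
  shows "vsa.smult (gr U) c f \<in> gr_carrier U"
proof -
  have "vsa.smult (gr U) c f \<in> (\<Pi>\<^sub>E q\<in>fracN T. coset (filt_pred U q) ` filt U q)"
    using rep_gr_carrier(1)[OF f] by (auto simp: gr_def subspace_scale[OF subspace_filt])
  moreover have "{q \<in> fracN T. vsa.smult (gr U) c f q \<noteq> coset (filt_pred U q) 0}
    \<subseteq> {q \<in> fracN T. f q \<noteq> coset (filt_pred U q) 0}"
  proof (rule subsetI, rule ccontr)
    fix q
    assume "q \<in> {q \<in> fracN T. vsa.smult (gr U) c f q \<noteq> coset (filt_pred U q) 0}"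
      and "q \<notin> {q \<in> fracN T. f q \<noteq> coset (filt_pred U q) 0}"
    then have q: "q \<in> fracN T" "f q = coset (filt_pred U q) 0"
      and ne: "vsa.smult (gr U) c f q \<noteq> coset (filt_pred U q) 0"
      by auto
    have "scale c (rep (f q)) \<in> filt_pred U q"
      using rep_coset[OF subspace_filt, of U "q - 1 / of_nat T" 0]
      unfolding q by (intro subspace_scale[OF subspace_filt]) simp
    then have "vsa.smult (gr U) c f q = coset (filt_pred U q) 0"
      using q by (simp add: gr_def coset_eq_iff[OF subspace_filt])
    with ne show False
      by simp
  qed
  then have "finite {q \<in> fracN T. vsa.smult (gr U) c f q \<noteq> coset (filt_pred U q) 0}"
    by (rule finite_subset) (use f in \<open>auto simp: gr_carrier_def\<close>)
  ultimately show ?thesis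
    by (simp add: gr_carrier_def)
qed

end

section \<open>Injectivity\<close>

context superspace
begin

abbreviation fock_coset :: "'v free \<Rightarrow> 'v free set" where
  "fock_coset \<equiv> coset (fock_ideal scale par)"

lemma fock_simps:
  "carrier (fock scale par) = range fock_coset"
  "vsa.add (fock scale par) A B = fock_coset (rep A + rep B)"
  "vsa.smult (fock scale par) c A = fock_coset (fscale c (rep A))"
  "vsa.product (fock scale par) A (- int k - 1) B
    = fock_coset (fscale (1 / fact k) ((free_deriv ^^ k) (rep A)) * rep B)"
  by (simp_all add: fock_def Let_def)

lemma fock_coset_eq_iff: "fock_coset a = fock_coset b \<longleftrightarrow> a - b \<in> fock_ideal scale par"
  by (rule fscale.coset_eq_iff[OF subspace_fock_ideal])

lemma fock_coset_rep: "A \<in> range fock_coset \<Longrightarrow> fock_coset (rep A) = A"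
  by (auto simp: fscale.coset_rep[OF subspace_fock_ideal])

lemma fock_coset_add:
  "fock_coset a = fock_coset a' \<Longrightarrow> fock_coset b = fock_coset b' \<Longrightarrow> fock_coset (a + b)
    = fock_coset (a' + b')"
  using fscale.subspace_add[OF subspace_fock_ideal, of "a - a'" scale par "b - b'"]
  by (simp add: fock_coset_eq_iff algebra_simps)

lemma fock_coset_fscale:
  "fock_coset a = fock_coset a' \<Longrightarrow> fock_coset (fscale c a) = fock_coset (fscale c a')"
  using fscale.subspace_scale[OF subspace_fock_ideal, of "a - a'" scale par c]
  by (simp add: fock_coset_eq_iff fscale.scale_right_diff_distrib)

end

section \<open>Leading terms and the transfer to V\<close>

context graded_vertex_superalgebra
begin

lemma exhaustive_filt:
  assumes U: "graded_subsuperspace U" "strongly_generated_by U"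
  obtains k where "x \<in> filt U (of_nat k / of_nat T)"
proof -
  let ?E = "\<lambda>k. filt U (of_nat k / of_nat T)"
  have mono: "?E j \<subseteq> ?E k" if "j \<le> k" for j k
    using that by (intro filt_mono divide_right_mono) simp_all
  have "subspace {x. \<exists>k. x \<in> ?E k}"
  proof (rule subspaceI)
    show "0 \<in> {x. \<exists>k. x \<in> ?E k}"
      by (simp add: subspace_0[OF subspace_filt])
    fix x y c
    assume "x \<in> {x. \<exists>k. x \<in> ?E k}"
    then obtain i where i: "x \<in> ?E i"
      by blast
    then show "scale c x \<in> {x. \<exists>k. x \<in> ?E k}"
      using subspace_scale[OF subspace_filt] by blast
    assume "y \<in> {x. \<exists>k. x \<in> ?E k}"
    then obtain j where "y \<in> ?E j"
      by blast
    with i have "x \<in> ?E (max i j)" "y \<in> ?E (max i j)"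
      using mono[of i "max i j"] mono[of j "max i j"] by auto
    then show "x + y \<in> {x. \<exists>k. x \<in> ?E k}"
      using subspace_add[OF subspace_filt] by blast
  qed
  moreover have "hom_monomial ws \<in> {x. \<exists>k. x \<in> ?E k}" if ws: "hom_gens U ws" for ws
  proof -
    obtain k where "weight ws = of_nat k / of_nat T"
      using weight_in_fracN[OF ws] by (auto simp: fracN_def)
    then have "hom_monomial ws \<in> ?E k"
      by (intro hom_monomial_in_filt[OF ws]) simp
    then show ?thesis
      by blast
  qed
  ultimately have "span {hom_monomial ws | ws. hom_gens U ws} \<subseteq> {x. \<exists>k. x \<in> ?E k}"
    by (intro span_minimal) auto
  then show thesis
    using that span_hom_monomials[OF U] by auto
qed

text \<open>On pairs of members of an adapted basis the total level of a term is well defined. The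
  terms of maximal level survive in \<open>gr\<close>, where Fock space injectivity together with
  the dual forms kills their coefficients.\<close>

lemma Y_free_kernel_on_basis:
  fixes hscale :: "complex \<Rightarrow> 'h::ab_group_add \<Rightarrow> 'h"
  assumes U: "graded_subsuperspace U" "strongly_generated_by U"
    and h: "superspace hscale hpar" and iso: "vsa_iso (gr U) (fock hscale hpar) \<phi>"
    and B: "independent B" "\<And>k. span {b \<in> B. lev b \<le> k} = filt U (of_nat k / of_nat T)"
    and p: "Poly_Mapping.keys p \<subseteq> B \<times> B" "\<And>k. Y_free p k = 0"
  shows "p = 0"
proof -
  interpret S: superspace hscale hpar
    by (rule h)
  let ?q = "coset (fock_ideal hscale hpar)"
  have gr_carrier: "carrier (gr U) = gr_carrier U"
    by (simp add: gr_def)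
  have \<phi>_add: "\<phi> (vsa.add (gr U) f g) = ?q (rep (\<phi> f) + rep (\<phi> g))"
    and \<phi>_smult: "\<phi> (vsa.smult (gr U) c f) = ?q (fscale c (rep (\<phi> f)))"
    and \<phi>_product: "\<phi> (vsa.product (gr U) f (- int k - 1) g)
      = ?q (fscale (1 / fact k) ((free_deriv ^^ k) (rep (\<phi> f))) * rep (\<phi> g))"
    if "f \<in> gr_carrier U" "g \<in> gr_carrier U" for f g c k
    using iso that by (auto simp: vsa_iso_def gr_carrier S.fock_simps)
  have bij: "bij_betw \<phi> (gr_carrier U) (range ?q)"
    using iso by (auto simp: vsa_iso_def gr_carrier S.fock_simps)
  have \<phi>_range: "\<phi> f \<in> range ?q" if "f \<in> gr_carrier U" for f
    using bij that by (auto simp: bij_betw_def)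
  define deg_of where "deg_of b = (of_nat (lev b) / of_nat T :: rat)" for b
  have deg_of: "deg_of b \<in> fracN T" for b
    unfolding deg_of_def fracN_def by blast
  have B_filt: "b \<in> filt U (deg_of b)" if "b \<in> B" for b
    unfolding deg_of_def B(2)[symmetric] using that by (intro span_base) simp
  have span_B: "x \<in> span B" for x
  proof -
    obtain k where "x \<in> filt U (of_nat k / of_nat T)"
      using exhaustive_filt[OF U] .
    then show ?thesis
      unfolding B(2)[symmetric] using span_mono[of "{b \<in> B. lev b \<le> k}" B] by blast
  qed
  \<comment> \<open>The previous step is spanned by basis vectors of smaller level. For level 0 its
    index is negative, so it is the zero space.\<close>
  have rep_filt_pred: "representation B x b = 0" if b: "b \<in> B" and x: "x \<in> filt_pred U (deg_of b)"
    for b x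
  proof (cases "lev b")
    case 0
    then have "deg_of b - 1 / of_nat T < 0"
      using T_pos by (simp add: deg_of_def)
    then have "x = 0"
      using x filt_negative by blast
    then show ?thesis
      by (simp add: representation_zero)
  next
    case (Suc k)
    have "deg_of b - 1 / of_nat T = of_nat k / of_nat T"
      by (simp add: deg_of_def Suc add_divide_distrib)
    then have "x \<in> span {b \<in> B. lev b \<le> k}"
      using x B(2)[of k] by simp
    then have "representation B x b = representation {b \<in> B. lev b \<le> k} x b"
      by (subst representation_extend[OF B(1)]) auto
    then show ?thesis
      using representation_ne_zero[of "{b \<in> B. lev b \<le> k}" x b] Suc by auto
  qed
  \<comment> \<open>Hence the coordinate does not depend on the representative picked by
    \<open>rep\<close>.\<close>
  have rep_coset_coeff: "representation B (rep (coset (filt_pred U (deg_of b)) x)) b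
    = representation B x b"
    if "b \<in> B" for b x
    using rep_filt_pred[OF that rep_coset[OF subspace_filt, of U _ x]]
    by (simp add: representation_diff[OF B(1) span_B span_B])

  define \<alpha> where "\<alpha> b = rep (\<phi> (gr_elem U (deg_of b) b))" for b
  define \<phi>' where "\<phi>' A = inv_into (gr_carrier U) \<phi> A" for A
  \<comment> \<open>\<open>\<theta> b\<close> is the coordinate form dual to the image of \<open>b\<close>, read off in \<open>gr\<^sub>E(V)\<close>.\<close>
  define \<theta> where "\<theta> b a = representation B (rep (\<phi>' (?q a) (deg_of b))) b" for b a
  have \<phi>': "\<phi>' (?q a) \<in> gr_carrier U" "\<phi> (\<phi>' (?q a)) = ?q a" for a
  proof -
    have "?q a \<in> \<phi> ` gr_carrier U"
      using bij by (simp add: bij_betw_def)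
    then show "\<phi>' (?q a) \<in> gr_carrier U" "\<phi> (\<phi>' (?q a)) = ?q a"
      unfolding \<phi>'_def by (rule inv_into_into, rule f_inv_into_f)
  qed
  have \<phi>'_\<phi>: "\<phi>' (\<phi> f) = f" if "f \<in> gr_carrier U" for f
    using bij that unfolding \<phi>'_def bij_betw_def by simp
  have q_\<phi>: "?q (rep (\<phi> f)) = \<phi> f" if "f \<in> gr_carrier U" for f
    by (rule S.fock_coset_rep[OF \<phi>_range[OF that]])

  have \<theta>: "S.fock_functional (\<theta> b)" if b: "b \<in> B" for b
  proof -
    have add: "\<theta> b (a + a') = \<theta> b a + \<theta> b a'" for a a'
    proof -
      have "?q (a + a') = \<phi> (vsa.add (gr U) (\<phi>' (?q a)) (\<phi>' (?q a')))"
        unfolding \<phi>_add[OF \<phi>'(1) \<phi>'(1)]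
        by (rule S.fock_coset_add) (simp_all add: \<phi>' S.fock_coset_rep)
      then have "\<phi>' (?q (a + a')) = vsa.add (gr U) (\<phi>' (?q a)) (\<phi>' (?q a'))"
        by (simp add: \<phi>'_\<phi> gr_carrier_add \<phi>')
      then show ?thesis
        by (simp add: \<theta>_def gr_def deg_of rep_coset_coeff[OF b] representation_add[OF B(1) span_B
          span_B])
    qed
    have scale: "\<theta> b (fscale c a) = c * \<theta> b a" for c a
    proof -
      have "?q (fscale c a) = \<phi> (vsa.smult (gr U) c (\<phi>' (?q a)))"
        unfolding \<phi>_smult[OF \<phi>'(1) \<phi>'(1)]
        by (rule S.fock_coset_fscale) (simp add: \<phi>' S.fock_coset_rep)
      then have "\<phi>' (?q (fscale c a)) = vsa.smult (gr U) c (\<phi>' (?q a))"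
        by (simp add: \<phi>'_\<phi> gr_carrier_smult \<phi>')
      then show ?thesis
        by (simp add: \<theta>_def gr_def deg_of rep_coset_coeff[OF b] representation_scale[OF B(1)
          span_B])
    qed
    have "\<theta> b a = 0" if "a \<in> fock_ideal hscale hpar" for a
    proof -
      have "?q a = ?q 0"
        using that by (simp add: S.fock_coset_eq_iff)
      \<comment> \<open>\<open>\<theta> b\<close> depends only on the coset; writing 0 as a scalar
        multiple lets homogeneity give the value 0.\<close>
      then have "\<theta> b a = \<theta> b (fscale 0 0)"
        by (simp add: \<theta>_def)
      then show ?thesis
        by (simp only: scale) simp
    qed
    with add scale show ?thesis
      by (simp add: S.fock_functional_def)
  qed
  \<comment> \<open>Different levels are separated by the degree in \<open>gr\<close>, equal levels
    by the coordinates in \<open>B\<close>.\<close>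
  have \<theta>_\<alpha>: "\<theta> b (\<alpha> b') = (if b' = b then 1 else 0)" if b: "b \<in> B" "b' \<in> B" for b b'
  proof -
    have "\<theta> b (\<alpha> b') = representation B (if deg_of b = deg_of b' then b' else 0) b"
    proof -
      have "gr_elem U (deg_of b') b' (deg_of b)
          = coset (filt_pred U (deg_of b)) (if deg_of b = deg_of b' then b' else 0)"
        by (simp only: gr_elem_def restrict_apply' deg_of)
      moreover have "\<phi>' (?q (\<alpha> b')) = gr_elem U (deg_of b') b'"
        using b by (simp add: \<alpha>_def q_\<phi> \<phi>'_\<phi> gr_elem_in_carrier B_filt)
      ultimately show ?thesis
        by (simp only: \<theta>_def rep_coset_coeff[OF b(1)])
    qed
    then show ?thesis
      using b by (auto simp: representation_basis[OF B(1)] representation_zero)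
  qed

  \<comment> \<open>\<open>vsa_iso\<close> provides only binary sums and scalar multiples of cosets;
    this assembles them into linear combinations within one degree.\<close>
  have \<phi>_sum: "?q (\<Sum>i\<in>I. fscale (c i) (t i)) = \<phi> (gr_elem U d (\<Sum>i\<in>I. scale (c i) (y i)))"
    if "finite I" "\<And>i. i \<in> I \<Longrightarrow> y i \<in> filt U d \<and> ?q (t i) = \<phi> (gr_elem U d (y i))"
    for I :: "('v \<times> 'v) set" and c t y d
    using that
  proof (induction I rule: finite_induct)
    case empty
    have 0: "gr_elem U d 0 \<in> gr_carrier U"
      by (rule gr_elem_in_carrier) (simp add: subspace_0[OF subspace_filt])
    from \<phi>_smult[OF 0 0, of 0] show ?case
      by (simp add: gr_elem_smult)
  next
    case (insert i I)
    let ?z = "\<Sum>i\<in>I. scale (c i) (y i)"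
    have y_filt: "y j \<in> filt U d" and t: "?q (t j) = \<phi> (gr_elem U d (y j))" if "j \<in> insert i I"
      for j
      using insert.prems that by blast+
    have y: "gr_elem U d (y i) \<in> gr_carrier U" "gr_elem U d (scale (c i) (y i)) \<in> gr_carrier U"
      by (intro gr_elem_in_carrier subspace_scale[OF subspace_filt] y_filt insertI1)+
    have z: "gr_elem U d ?z \<in> gr_carrier U"
      by (intro gr_elem_in_carrier subspace_sum[OF subspace_filt] subspace_scale[OF subspace_filt]
        y_filt insertI2)
    have "?q (fscale (c i) (t i)) = \<phi> (gr_elem U d (scale (c i) (y i)))"
      unfolding gr_elem_smult[symmetric] \<phi>_smult[OF y(1) y(1)]
      by (rule S.fock_coset_fscale) (simp add: q_\<phi>[OF y(1)] t)
    moreover have "?q (\<Sum>i\<in>I. fscale (c i) (t i)) = \<phi> (gr_elem U d ?z)"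
      using y_filt t by (intro insert.IH) blast
    ultimately have "?q (fscale (c i) (t i) + (\<Sum>i\<in>I. fscale (c i) (t i)))
      = \<phi> (vsa.add (gr U) (gr_elem U d (scale (c i) (y i))) (gr_elem U d ?z))"
      unfolding \<phi>_add[OF y(2) z] by (intro S.fock_coset_add) (simp_all add: q_\<phi>[OF y(2)] q_\<phi>[OF z])
    then show ?case
      using insert.hyps by (simp add: gr_elem_add)
  qed

  show "p = 0"
  proof (rule ccontr)
    assume "p \<noteq> 0"
    then have ne: "Poly_Mapping.keys p \<noteq> {}"
      by simp
    let ?c = "Poly_Mapping.lookup p"
    define l where "l x = lev (fst x) + lev (snd x)" for x
    define m where "m = Max (l ` Poly_Mapping.keys p)"
    have l_le: "l x \<le> m" if "x \<in> Poly_Mapping.keys p" for x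
      unfolding m_def using that by (intro Max_ge) auto
    define L where "L = {x \<in> Poly_Mapping.keys p. l x = m}"
    have "m \<in> l ` Poly_Mapping.keys p"
      unfolding m_def using ne by (intro Max_in) auto
    then obtain b0 b1 where b01: "(b0, b1) \<in> L"
      by (auto simp: L_def)
    have L: "finite L" "L \<subseteq> B \<times> B" "L \<subseteq> Poly_Mapping.keys p"
      using p(1) by (auto simp: L_def)
    define M where "M = (of_nat m / of_nat T :: rat)"
    have M: "deg_of (fst x) + deg_of (snd x) = of_nat (l x) / of_nat T" for x
      by (simp add: deg_of_def l_def add_divide_distrib)
    have mem: "mode (fst x) n (snd x) \<in> filt U (of_nat (l x) / of_nat T)" if "x
      \<in> Poly_Mapping.keys p" for x n
      unfolding M[symmetric] using that p(1) by (intro mode_filt[OF U] B_filt) auto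
    \<comment> \<open>The top part is minus the rest. Levels are integers, so the rest has total
      level at most m - 1, which is exactly one step of 1/T lower.\<close>
    have lead: "(\<Sum>x\<in>L. scale (?c x) (mode (fst x) (- int k - 1) (snd x))) \<in> filt_pred U M" for k
    proof -
      let ?t = "\<lambda>x. scale (?c x) (mode (fst x) (- int k - 1) (snd x))"
      have "(\<Sum>x\<in>Poly_Mapping.keys p. ?t x) = 0"
        using p(2)[of "int k"] by (simp add: Y_free_def Y_map_def)
      then have "(\<Sum>x\<in>L. ?t x) = - (\<Sum>x\<in>Poly_Mapping.keys p - L. ?t x)"
        using sum.subset_diff[OF L(3), of ?t] by (simp add: eq_neg_iff_add_eq_0 add.commute)
      moreover have "?t x \<in> filt_pred U M" if x: "x \<in> Poly_Mapping.keys p - L" for x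
      proof -
        have "l x < m"
          using x l_le[of x] by (auto simp: L_def)
        then have "(of_nat (l x) + 1 :: rat) \<le> of_nat m"
          by (metis Suc_leI of_nat_Suc of_nat_le_iff add.commute)
        then have "of_nat (l x) / of_nat T \<le> M - 1 / of_nat T"
          unfolding M_def diff_divide_distrib[symmetric] by (intro divide_right_mono) auto
        then show ?thesis
          using mem[of x "- int k - 1"] x filt_mono
            by (intro subspace_scale[OF subspace_filt]) blast
      qed
      then have "(\<Sum>x\<in>Poly_Mapping.keys p - L. ?t x) \<in> filt_pred U M"
        by (intro subspace_sum[OF subspace_filt])
      ultimately show ?thesis
        by (simp only: subspace_neg[OF subspace_filt])
    qed
    \<comment> \<open>The exponents k \<ge> 0 of z correspond to the modes -k-1, where the Fock
      product is given by \<partial>^k / k!. The coefficient is moved into the second factor and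
      1/k! is cleared to fit \<open>fock_Y_injective\<close>.\<close>
    have "(\<Sum>x\<in>L. (free_deriv ^^ k) (\<alpha> (fst x)) * fscale (?c x) (\<alpha> (snd x)))
      \<in> fock_ideal hscale hpar" for k
    proof -
      let ?s = "\<lambda>x. (free_deriv ^^ k) (\<alpha> (fst x)) * \<alpha> (snd x)"
      let ?y = "\<lambda>x. mode (fst x) (- int k - 1) (snd x)"
      have "?q (\<Sum>x\<in>L. fscale (?c x) (fscale (1 / fact k) (?s x)))
        = \<phi> (gr_elem U M (\<Sum>x\<in>L. scale (?c x) (?y x)))"
      proof (rule \<phi>_sum[OF L(1)])
        fix x assume x: "x \<in> L"
        then have xB: "fst x \<in> B" "snd x \<in> B" and lx: "deg_of (fst x) + deg_of (snd x) = M"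
          using L(2) unfolding M M_def by (auto simp: L_def)
        have "\<phi> (vsa.product (gr U) (gr_elem U (deg_of (fst x)) (fst x)) (- int k - 1) (gr_elem U
          (deg_of (snd x)) (snd x)))
          = ?q (fscale (1 / fact k) ((free_deriv ^^ k) (\<alpha> (fst x))) * \<alpha> (snd x))"
          unfolding \<alpha>_def by (intro \<phi>_product gr_elem_in_carrier B_filt xB)
        then have "?q (fscale (1 / fact k) (?s x)) = \<phi> (gr_elem U M (?y x))"
          by (simp add: gr_elem_product[OF U deg_of deg_of B_filt[OF xB(1)] B_filt[OF xB(2)]] lx
            fscale_mult_left)
        moreover have "?y x \<in> filt U M"
          using mode_filt[OF U B_filt[OF xB(1)] B_filt[OF xB(2)]] by (simp add: lx)
        ultimately show "?y x \<in> filt U M \<and> ?q (fscale (1 / fact k) (?s x)) = \<phi> (gr_elem U M (?y x))"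
          by simp
      qed
      also have "\<dots> = \<phi> (gr_elem U M 0)"
        by (simp only: gr_elem_eq_0[OF lead])
      also have "\<dots> = ?q 0"
        using \<phi>_sum[of "{}" "\<lambda>x. 0" M "\<lambda>x. 0" "\<lambda>x. 0"] by simp
      finally have "(\<Sum>x\<in>L. fscale (?c x) (fscale (1 / fact k) (?s x))) \<in> fock_ideal hscale hpar"
        by (simp add: S.fock_coset_eq_iff)
      from fscale.subspace_scale[OF subspace_fock_ideal this, of "fact k"]
      show ?thesis
        by (simp add: fscale.scale_sum_right fscale.scale_scale fscale_mult_right mult.left_commute)
    qed
    \<comment> \<open>The forms dual to \<open>b0\<close> and \<open>b1\<close> isolate the
      coefficient of one leading pair.\<close>
    from S.fock_Y_injective[OF \<theta> \<theta> L(1) this, of b0 b1] b01 L(2)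
    have "(\<Sum>x\<in>L. \<theta> b0 (\<alpha> (fst x)) * \<theta> b1 (fscale (?c x) (\<alpha> (snd x)))) = 0"
      by blast
    moreover have "\<theta> b0 (\<alpha> (fst x)) * \<theta> b1 (fscale (?c x) (\<alpha> (snd x))) = (if x
      = (b0, b1) then ?c x else 0)"
      if "x \<in> L" for x
    proof -
      have "fst x \<in> B" "snd x \<in> B" "b0 \<in> B" "b1 \<in> B"
        using L(2) b01 that by auto
      then show ?thesis
        by (cases x) (auto simp: S.fock_functionalD(2)[OF \<theta>] \<theta>_\<alpha>)
    qed
    ultimately have "(\<Sum>x\<in>L. if x = (b0, b1) then ?c x else 0) = 0"
      by simp
    then have "?c (b0, b1) = 0"
      using L(1) b01 by simp
    with b01 show False
      by (simp add: L_def in_keys_iff)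
  qed
qed

text \<open>Bilinear expansion modulo the tensor relations: with the left entry in \<open>B\<close>,
  the right entry is freed first, then the left one. Both steps work because \<open>Q\<close> is a
  subspace stable under adding relations.\<close>

lemma tensor_basis_representative:
  assumes B: "span B = UNIV"
  obtains q where "Poly_Mapping.keys q \<subseteq> B \<times> B" "p - q \<in> fscale.span (tensor_relations scale scale)"
proof -
  let ?K = "fscale.span (tensor_relations scale scale)"
  define Q where "Q = {p. \<exists>q. Poly_Mapping.keys q \<subseteq> B \<times> B \<and> p - q \<in> ?K}"
  have subspace_Q: "fscale.subspace Q"
    unfolding Q_def
  proof (rule fscale.subspaceI)
    show "0 \<in> {p. \<exists>q. Poly_Mapping.keys q \<subseteq> B \<times> B \<and> p - q \<in> ?K}"
      by (auto intro!: exI[of _ 0] fscale.span_zero)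
    fix x y c
    assume "x \<in> {p. \<exists>q. Poly_Mapping.keys q \<subseteq> B \<times> B \<and> p - q \<in> ?K}"
    then obtain q where q: "Poly_Mapping.keys q \<subseteq> B \<times> B" "x - q \<in> ?K"
      by blast
    have "Poly_Mapping.keys (fscale c q) \<subseteq> B \<times> B" "fscale c x - fscale c q \<in> ?K"
      using q fscale.span_scale[OF q(2), of c] by (auto simp: in_keys_iff
        fscale.scale_right_diff_distrib)
    then show "fscale c x \<in> {p. \<exists>q. Poly_Mapping.keys q \<subseteq> B \<times> B \<and> p - q \<in> ?K}"
      by blast
    assume "y \<in> {p. \<exists>q. Poly_Mapping.keys q \<subseteq> B \<times> B \<and> p - q \<in> ?K}"
    then obtain r where r: "Poly_Mapping.keys r \<subseteq> B \<times> B" "y - r \<in> ?K"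
      by blast
    have "Poly_Mapping.keys (q + r) \<subseteq> B \<times> B"
      using Poly_Mapping.keys_add[of q r] q(1) r(1) by blast
    moreover have "x + y - (q + r) \<in> ?K"
      using fscale.span_add[OF q(2) r(2)] by (simp add: algebra_simps)
    ultimately show "x + y \<in> {p. \<exists>q. Poly_Mapping.keys q \<subseteq> B \<times> B \<and> p - q \<in> ?K}"
      by blast
  qed
  have K: "?K \<subseteq> Q"
    unfolding Q_def by (auto intro!: exI[of _ 0])
  have add_l: "pure (u + u', v) - pure (u, v) - pure (u', v) \<in> ?K"
    and add_r: "pure (u, v + v') - pure (u, v) - pure (u, v') \<in> ?K"
    and scale_l: "pure (scale c u, v) - fscale c (pure (u, v)) \<in> ?K"
    and scale_r: "pure (u, scale c v) - fscale c (pure (u, v)) \<in> ?K" for u u' v v' c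
    unfolding tensor_relations_def by (rule fscale.span_base, blast)+
  have Q_cong: "a \<in> Q" if "a - b \<in> ?K" "b \<in> Q" for a b
    using fscale.subspace_add[OF subspace_Q subsetD[OF K that(1)] that(2)] by simp
  have zero_l: "pure (0, v) \<in> Q" and zero_r: "pure (v, 0) \<in> Q" for v
    using scale_l[of 0 0 v] scale_r[of v 0 0] K by auto
  have right: "pure (b, v) \<in> Q" if b: "b \<in> B" for b v
  proof -
    have "subspace {v. pure (b, v) \<in> Q}"
    proof (rule subspaceI)
      fix v v' c assume v: "v \<in> {v. pure (b, v) \<in> Q}"
      show "scale c v \<in> {v. pure (b, v) \<in> Q}"
        using Q_cong[OF scale_r[of b c v]] fscale.subspace_scale[OF subspace_Q, of _ c] v by blast
      assume v': "v' \<in> {v. pure (b, v) \<in> Q}"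
      have "pure (b, v + v') - (pure (b, v) + pure (b, v')) \<in> ?K"
        using add_r[of b v v'] by (simp only: diff_diff_add)
      from Q_cong[OF this] show "v + v' \<in> {v. pure (b, v) \<in> Q}"
        using fscale.subspace_add[OF subspace_Q] v v' by simp
    qed (use zero_r in simp)
    moreover have "B \<subseteq> {v. pure (b, v) \<in> Q}"
      proof
      fix b' assume "b' \<in> B"
      then have "Poly_Mapping.keys (pure (b, b')) \<subseteq> B \<times> B" "pure (b, b') - pure (b, b') \<in> ?K"
        using b by (simp_all add: fscale.span_zero)
      then show "b' \<in> {v. pure (b, v) \<in> Q}"
        unfolding Q_def by blast
    qed
    ultimately show ?thesis
      using span_minimal[of B "{v. pure (b, v) \<in> Q}"] B by blast
  qed
  have pure: "pure (u, v) \<in> Q" for u v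
  proof -
    have "subspace {u. pure (u, v) \<in> Q}"
    proof (rule subspaceI)
      fix u u' c assume u: "u \<in> {u. pure (u, v) \<in> Q}"
      show "scale c u \<in> {u. pure (u, v) \<in> Q}"
        using Q_cong[OF scale_l[of c u v]] fscale.subspace_scale[OF subspace_Q, of _ c] u by blast
      assume u': "u' \<in> {u. pure (u, v) \<in> Q}"
      have "pure (u + u', v) - (pure (u, v) + pure (u', v)) \<in> ?K"
        using add_l[of u u' v] by (simp only: diff_diff_add)
      from Q_cong[OF this] show "u + u' \<in> {u. pure (u, v) \<in> Q}"
        using fscale.subspace_add[OF subspace_Q] u u' by simp
    qed (use zero_l in simp)
    then show ?thesis
      using span_minimal[of B "{u. pure (u, v) \<in> Q}"] right B by blast
  qed
  have "p \<in> Q"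
  proof (induction p rule: poly_mapping_additive_induct)
    case (single x c)
    then show ?case
      using fscale.subspace_scale[OF subspace_Q pure[of "fst x" "snd x"], of c] by simp
  next
    case (add a b)
    then show ?case
      by (rule fscale.subspace_add[OF subspace_Q])
  qed
  then show thesis
    using that unfolding Q_def by blast
qed

end

theorem theorem4p3:
  fixes scale :: "complex \<Rightarrow> 'v::ab_group_add \<Rightarrow> 'v"
    and par :: "bit \<Rightarrow> 'v set"
    and vac :: 'v
    and mode :: "'v \<Rightarrow> int \<Rightarrow> 'v \<Rightarrow> 'v"
    and T :: nat
    and deg :: "rat \<Rightarrow> 'v set"
  assumes "T > 0"
    and "graded_vertex_superalgebra scale par vac mode T deg"
    and "graded_vertex_superalgebra.admits_PBW_basis scale par vac mode T deg
           TYPE('h::ab_group_add)"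
  shows "inj_on (vertex_superalgebra.Y_tensor scale mode) (tensor_product scale scale)"
proof -
  interpret graded_vertex_superalgebra scale par vac mode T deg
    by (rule assms(2))
  obtain U and hscale :: "complex \<Rightarrow> 'h \<Rightarrow> 'h" and hpar \<phi>
    where U: "graded_subsuperspace U" "strongly_generated_by U" and h: "superspace hscale hpar"
      and iso: "vsa_iso (gr U) (fock hscale hpar) \<phi>"
    using assms(3) unfolding admits_PBW_basis_def vsa_isomorphic_def by blast
  let ?E = "\<lambda>k::nat. filt U (of_nat k / of_nat T)"
  have "?E k \<subseteq> ?E (Suc k)" for k
    by (intro filt_mono divide_right_mono) simp_all
  then obtain B lev where B: "independent B" "\<And>k. span {b \<in> B. lev b \<le> k} = ?E k"
    using filtered_basis[of ?E] subspace_filt by blast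
  have span_B: "span B = UNIV"
  proof -
    have "x \<in> span B" for x
    proof -
      obtain k where "x \<in> ?E k"
        using exhaustive_filt[OF U] .
      then show ?thesis
        unfolding B(2)[symmetric] using span_mono[of "{b \<in> B. lev b \<le> k}" B] by blast
    qed
    then show ?thesis
      by blast
  qed
  let ?K = "fscale.span (tensor_relations scale scale)"
  \<comment> \<open>\<open>q\<close> vanishes already as a formal combination of pairs, so
    \<open>p\<close> itself lies in the span of the relations.\<close>
  have kernel: "p \<in> ?K" if p: "\<And>k. Y_free p k = 0" for p
  proof -
    obtain q where q: "Poly_Mapping.keys q \<subseteq> B \<times> B" "p - q \<in> ?K"
      using tensor_basis_representative[OF span_B] .
    have "Y_free q k = 0" for k
      using Y_free_relations[OF q(2), of k] p[of k] by (simp add: Y_free_diff)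
    with q(1) have "q = 0"
      by (rule Y_free_kernel_on_basis[OF U h iso B])
    with q(2) show ?thesis
      by simp
  qed
  show ?thesis
  proof (rule inj_onI)
    fix X Y
    assume "X \<in> tensor_product scale scale" "Y \<in> tensor_product scale scale"
      and eq: "Y_tensor X = Y_tensor Y"
    then obtain p q where pq: "X = tensor_coset scale scale p" "Y = tensor_coset scale scale q"
      by (auto simp: tensor_product_def)
    have "Y_free (p - q) k = 0" for k
      using fun_cong[OF eq, of k] by (simp add: pq Y_tensor_coset Y_free_diff)
    then have "p - q \<in> ?K"
      by (rule kernel)
    then show "X = Y"
      by (simp add: pq tensor_coset_def fscale.coset_eq_iff[OF fscale.subspace_span])
  qed
qed

end
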